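(* Let $G$ be a graph with a spanning triangle-tree. Then $G$ is not $\mathbb{Z}_3$-connected if and only if one of the following holds: (i) $G$ is $K_3$ or $K_4$; (ii) $G=K_3\bigoplus_2 G_1$ for some graph $G_1$ that is not $\mathbb{Z}_3$-connected and contains a spanning triangle-tree; (iii) $G$ is a bull-growing of some graph $H$ that is not $\mathbb{Z}_3$-connected and contains a spanning triangle-tree.
   Context: Graphs are finite, may contain parallel edges, but have no loops. Triangle-tree: a graph formed by starting with a triangle $x_1x_2x_3$ and then repeatedly (zero or more times) adding a new vertex $x_{j+1}$ joined to exactly two vertices $y,z$ that are adjacent in the graph already constructed (so $x_{j+1},y,z$ form a triangle). A spanning triangle-tree of $G$ is a subgraph of $G$ that is a triangle-tree and contains all vertices of $G$. $\mathbb{Z}_3$-connected: a $\mathbb{Z}_3$-boundary of $G$ is a map $\beta:V(G)\to\mathbb{Z}_3$ with $\sum_{v\in V(G)}\beta(v)\equiv 0\pmod 3$. $G$ is $\mathbb{Z}_3$-connected if for every $\mathbb{Z}_3$-boundary $\beta$ there is an orientation $D$ of $G$ with $d_D^+(v)-d_D^-(v)\equiv\beta(v)\pmod 3$ for every vertex $v$ (out-degree minus in-degree). $2$-sum: for subgraphs $A,B$ of $G$, $G=A\bigoplus_2 B$ means $E(G)=E(A)\cup E(B)$, $|E(A)\cap E(B)|=1$ and $|V(A)\cap V(B)|=2$ (with $V(G)=V(A)\cup V(B)$). In $G=K_3\bigoplus_2 G_1$, the subgraph $A$ is a triangle. Bull-reduction / bull-growing: let $u,v$ be two adjacent vertices of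 degree $3$ in a graph $G$ with a common neighbor $w$; let $a$ be the third neighbor of $u$ (other than $v,w$) and $b$ the third neighbor of $v$ (other than $u,w$); $a=b$ is allowed. Let $H=G-u-v+ab$, i.e. delete $u,v$ and add a new edge $ab$ (possibly parallel to existing edges), where if $a=b$ the resulting loop is deleted (so $H=G-u-v$). Then $H$ is called a bull-reduction of $G$, and $G$ is called a bull-growing of $H$. *)

theory Defs
  imports Graph_Theory.Digraph "HOL-Number_Theory.Cong"
begin

record ('v, 'e) mgraph =
  vertices :: "'v set"
  edges :: "'e set"
  ends :: "'e \<Rightarrow> 'v set"

text \<open>
  Finite graphs, possibly with parallel edges (distinct edges with equal ends), without loops.
  The value of \<open>ends\<close> outside the edge set is irrelevant.
\<close>

definition multigraph :: "('v, 'e) mgraph \<Rightarrow> bool" where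
  "multigraph G \<longleftrightarrow> finite (vertices G) \<and> finite (edges G) \<and>
     (\<forall>e\<in>edges G. ends G e \<subseteq> vertices G \<and> card (ends G e) = 2)"

definition adjacent :: "('v, 'e) mgraph \<Rightarrow> 'v \<Rightarrow> 'v \<Rightarrow> bool" where
  "adjacent G u v \<longleftrightarrow> (\<exists>e\<in>edges G. ends G e = {u, v})"

definition degree :: "('v, 'e) mgraph \<Rightarrow> 'v \<Rightarrow> nat" where
  "degree G v = card {e \<in> edges G. v \<in> ends G e}"

definition subgraph_of :: "('v, 'e) mgraph \<Rightarrow> ('v, 'e) mgraph \<Rightarrow> bool" where
  "subgraph_of H G \<longleftrightarrow> multigraph H \<and> multigraph G \<and>
     vertices H \<subseteq> vertices G \<and> edges H \<subseteq> edges G \<and> (\<forall>e\<in>edges H. ends H e = ends G e)"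

text \<open>\<open>complete_graph n G\<close>: the graph \<open>G\<close> is (isomorphic to) the simple complete graph on \<open>n\<close> vertices.\<close>

definition complete_graph :: "nat \<Rightarrow> ('v, 'e) mgraph \<Rightarrow> bool" where
  "complete_graph n G \<longleftrightarrow> multigraph G \<and> card (vertices G) = n \<and>
     (\<forall>u\<in>vertices G. \<forall>v\<in>vertices G. u \<noteq> v \<longrightarrow> (\<exists>!e. e \<in> edges G \<and> ends G e = {u, v}))"

definition add_vertex :: "('v, 'e) mgraph \<Rightarrow> 'v \<Rightarrow> ('v, 'e) mgraph" where
  "add_vertex G x = G\<lparr>vertices := insert x (vertices G)\<rparr>"

definition add_edge :: "('v, 'e) mgraph \<Rightarrow> 'e \<Rightarrow> 'v \<Rightarrow> 'v \<Rightarrow> ('v, 'e) mgraph" where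
  "add_edge G e x y = G\<lparr>edges := insert e (edges G), ends := (ends G)(e := {x, y})\<rparr>"

definition delete_vertices :: "('v, 'e) mgraph \<Rightarrow> 'v set \<Rightarrow> ('v, 'e) mgraph" where
  "delete_vertices G S =
     G\<lparr>vertices := vertices G - S, edges := {e \<in> edges G. ends G e \<inter> S = {}}\<rparr>"

inductive triangle_tree :: "('v, 'e) mgraph \<Rightarrow> bool" where
  triangle: "complete_graph 3 T \<Longrightarrow> triangle_tree T"
| extend: "\<lbrakk>triangle_tree T; x \<notin> vertices T; adjacent T y z;
            e \<notin> edges T; f \<notin> edges T; e \<noteq> f\<rbrakk>
     \<Longrightarrow> triangle_tree (add_edge (add_edge (add_vertex T x) e x y) f x z)"

definition has_spanning_triangle_tree :: "('v, 'e) mgraph \<Rightarrow> bool" where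
  "has_spanning_triangle_tree G \<longleftrightarrow>
     (\<exists>T. triangle_tree T \<and> subgraph_of T G \<and> vertices T = vertices G)"

definition orientation :: "('v, 'e) mgraph \<Rightarrow> ('v, 'e) pre_digraph \<Rightarrow> bool" where
  "orientation G D \<longleftrightarrow> verts D = vertices G \<and> arcs D = edges G \<and>
     (\<forall>e\<in>edges G. {tail D e, head D e} = ends G e)"

text \<open>Maps into the integers modulo 3 are given by integer representatives.\<close>

definition Z3_boundary :: "('v, 'e) mgraph \<Rightarrow> ('v \<Rightarrow> int) \<Rightarrow> bool" where
  "Z3_boundary G \<beta> \<longleftrightarrow> [(\<Sum>v\<in>vertices G. \<beta> v) = 0] (mod 3)"

definition Z3_connected :: "('v, 'e) mgraph \<Rightarrow> bool" where
  "Z3_connected G \<longleftrightarrow> (\<forall>\<beta>. Z3_boundary G \<beta> \<longrightarrow>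
     (\<exists>D. orientation G D \<and>
        (\<forall>v\<in>vertices G. [int (out_degree D v) - int (in_degree D v) = \<beta> v] (mod 3))))"

definition two_sum :: "('v, 'e) mgraph \<Rightarrow> ('v, 'e) mgraph \<Rightarrow> ('v, 'e) mgraph \<Rightarrow> bool" where
  "two_sum G A B \<longleftrightarrow> subgraph_of A G \<and> subgraph_of B G \<and>
     vertices G = vertices A \<union> vertices B \<and> edges G = edges A \<union> edges B \<and>
     card (edges A \<inter> edges B) = 1 \<and> card (vertices A \<inter> vertices B) = 2"

text \<open>
  The new edge \<open>ab\<close> may be any \<open>e\<close> that is not an edge of \<open>G - u - v\<close>. Edges of \<open>G\<close> at \<open>u\<close> or \<open>v\<close>
  qualify, so such an \<open>e\<close> always exists, whatever the type of edges.
\<close>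

definition bull_reduction :: "('v, 'e) mgraph \<Rightarrow> ('v, 'e) mgraph \<Rightarrow> bool" where
  "bull_reduction G H \<longleftrightarrow> multigraph G \<and>
     (\<exists>u v w a b e.
        adjacent G u v \<and> degree G u = 3 \<and> degree G v = 3 \<and>
        adjacent G u w \<and> adjacent G v w \<and>
        adjacent G u a \<and> a \<noteq> v \<and> a \<noteq> w \<and>
        adjacent G v b \<and> b \<noteq> u \<and> b \<noteq> w \<and>
        e \<notin> edges (delete_vertices G {u, v}) \<and>
        H = (if a = b then delete_vertices G {u, v}
             else add_edge (delete_vertices G {u, v}) e a b))"

definition bull_growing :: "('v, 'e) mgraph \<Rightarrow> ('v, 'e) mgraph \<Rightarrow> bool" where
  "bull_growing H G \<longleftrightarrow> bull_reduction G H"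

end

(*
  Call x, y linked if the realizable boundaries are closed under adding 1 at x and subtracting it
  at y. A graph is Z3-connected iff all its vertices are linked. Two parallel edges link their ends,
  and a vertex with two edges to linked vertices is linked to them; hence a spanning triangle-tree
  with one doubled edge links everything. A vertex of degree 2 and a bull can be removed
  without changing Z3-connectivity (in a bull, a nonzero value at u or v is settled by lifting two
  edges at that vertex, which doubles a tree edge).

  A triangle-tree on at least 4 vertices ends in a fan: a vertex v on an edge wb of a smaller
  triangle-tree, followed by leaves on the edges vw and vb. If G is not Z3-connected and no leaf has
  degree 2, then every leaf has degree 3, since at a leaf of larger degree the two tree edges
  could be lifted. If two leaves are adjacent, or v has degree 3, there is a bull (or K4).
  Otherwise lifting the edges vw and vb shows that G is Z3-connected.
*)
theory Submission imports Defs "HOL-Library.Numeral_Type" "HOL-Library.Function_Algebras" "HOL-Library.Multiset"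
begin

section \<open>Flows modulo 3 on multisets of unordered pairs\<close>

text \<open>A leaf of degree 3 need not lie in a bull, since its third neighbour may have large
  degree. This is why all leaves around the vertex \<open>v\<close> of a fan are treated together:
  if each has its third neighbour in the core \<open>V0\<close>, then deleting \<open>v\<close>
  costs every leaf just one edge and leaves two edges into the core, so the core, once
  \<open>wb\<close> is doubled, links all leaves, and \<open>v\<close> is attached last.

  The exceptional graphs come from the size bound on triangle-trees: K_3 is a single edge with an
  ear, K_4 is a single edge grown by a bull with a = b, and a single edge is not a triangle-tree.

  In a bull, lifting cannot serve the value 0, as the one edge left over contributes 1 or -1. But 0
  at a vertex of degree 3 forces a source or a sink, and this makes u and v together act as one edge
  ab.\<close>

definition arc :: "'v \<Rightarrow> 'v \<Rightarrow> 'v \<Rightarrow> 3" where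
  "arc x y = (\<lambda>p. of_bool (p = x) - of_bool (p = y))"

text \<open>
  A graph is represented by the multiset of the vertex pairs of its edges. A pair \<open>{x, x}\<close> is allowed
  and has no effect, since \<open>arc x x = 0\<close>; this covers the bull-reduction with \<open>a = b\<close>.
\<close>

definition realizes :: "'v set multiset \<Rightarrow> ('v \<Rightarrow> 3) \<Rightarrow> bool" where
  "realizes M f \<longleftrightarrow> (\<exists>A. image_mset (\<lambda>(x, y). {x, y}) A = M \<and> f = (\<Sum>(x, y)\<in>#A. arc x y))"

text \<open>Functions are total, so boundaries are taken to be 0 outside \<open>V\<close>, as is
  everything realized by edges inside \<open>V\<close>.\<close>

definition Z3_con :: "'v set \<Rightarrow> 'v set multiset \<Rightarrow> bool" where
  "Z3_con V M \<longleftrightarrow> (\<forall>f. (\<forall>p. p \<notin> V \<longrightarrow> f p = 0) \<longrightarrow> sum f V = 0 \<longrightarrow> realizes M f)"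

text \<open>
  Since \<open>3 * arc x y = 0\<close>, closure under adding \<open>arc x y\<close> is an equivalence relation in \<open>x\<close> and \<open>y\<close>.
  Unlike realizability of a single function, it survives the addition of edges.
\<close>

definition linked :: "'v set multiset \<Rightarrow> 'v \<Rightarrow> 'v \<Rightarrow> bool" where
  "linked M x y \<longleftrightarrow> (\<forall>f. realizes M f \<longrightarrow> realizes M (f + arc x y))"

lemma three_cases:
  fixes s :: 3
  obtains "s = 0" | "s = 1" | "s = -1"
proof -
  have "s = 0 \<or> s = 1 \<or> s = -1"
  proof (cases s)
    case (of_int z)
    then have "z = 0 \<or> z = 1 \<or> z = 2" by auto
    moreover have "(2 :: 3) = -1" by simp
    ultimately show ?thesis using of_int by auto
  qed
  then show thesis using that by blast
qed

lemma triple_zero [simp]: "3 * x = (0 :: 3)"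
proof -
  have "(3 :: 3) = 0" by simp
  then show ?thesis by (simp only: mult_zero_left)
qed

text \<open>The form in which characteristic 3 enters \<open>linked_sym\<close> and
  \<open>linked_attach\<close>.\<close>

lemma fun_double: "2 * f = - (f :: 'v \<Rightarrow> 3)"
proof (rule ext)
  fix p
  have "2 * f p + f p = 3 * f p" by simp
  then have "2 * f p = - f p" by (simp only: triple_zero eq_neg_iff_add_eq_0)
  then show "(2 * f) p = (- f) p" by simp
qed

lemma arc_refl [simp]: "arc x x = 0"
  by (simp add: arc_def fun_eq_iff)

lemma arc_flip: "arc y x = - arc x y"
  by (simp add: arc_def fun_eq_iff)

lemma arc_chain: "arc x y + arc y z = arc x z"
  by (simp add: arc_def fun_eq_iff)

lemma sum_arc: "finite V \<Longrightarrow> x \<in> V \<Longrightarrow> y \<in> V \<Longrightarrow> sum (arc x y) V = 0"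
  by (simp add: arc_def sum_subtractf)

lemma realizes_empty [simp]: "realizes {#} f \<longleftrightarrow> f = 0"
  by (auto simp: realizes_def)

lemma realizes_add_iff:
  "realizes (add_mset {x, y} M) f \<longleftrightarrow> realizes M (f - arc x y) \<or> realizes M (f + arc x y)"
proof
  assume "realizes (add_mset {x, y} M) f"
  then obtain A where A: "image_mset (\<lambda>(x, y). {x, y}) A = add_mset {x, y} M"
    "f = (\<Sum>(x, y)\<in>#A. arc x y)" unfolding realizes_def by blast
  from msed_map_invR[OF A(1)] obtain B a where B: "A = add_mset a B"
    "(\<lambda>(x, y). {x, y}) a = {x, y}" "image_mset (\<lambda>(x, y). {x, y}) B = M" by blast
  obtain c d where a: "a = (c, d)" by (cases a)
  have R: "realizes M (\<Sum>(x, y)\<in>#B. arc x y)" using B(3) by (auto simp: realizes_def)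
  have f: "f = arc c d + (\<Sum>(x, y)\<in>#B. arc x y)" using A(2) B(1) a by simp
  have "c = x \<and> d = y \<or> c = y \<and> d = x" using B(2) a by (auto simp: doubleton_eq_iff)
  then show "realizes M (f - arc x y) \<or> realizes M (f + arc x y)"
  proof
    assume "c = x \<and> d = y"
    then have "f - arc x y = (\<Sum>(x, y)\<in>#B. arc x y)" using f by simp
    then show ?thesis using R by simp
  next
    assume "c = y \<and> d = x"
    then have "f + arc x y = (\<Sum>(x, y)\<in>#B. arc x y)" using f arc_flip[of y x] by simp
    then show ?thesis using R by simp
  qed
next
  have *: "realizes (add_mset {x, y} M) f" if "realizes M (f - arc x y)" for f x y
  proof -
    from that obtain A where A: "image_mset (\<lambda>(x, y). {x, y}) A = M"
      "f - arc x y = (\<Sum>(x, y)\<in>#A. arc x y)" unfolding realizes_def by blast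
    have "f = arc x y + (\<Sum>(x, y)\<in>#A. arc x y)" using A(2)[symmetric] by simp
    then show ?thesis using A(1) unfolding realizes_def
      by (intro exI[of _ "add_mset (x, y) A"]) simp
  qed
  assume "realizes M (f - arc x y) \<or> realizes M (f + arc x y)"
  then show "realizes (add_mset {x, y} M) f"
    using *[of f x y] *[of f y x] arc_flip[of x y] by (auto simp: insert_commute)
qed

lemma realizes_union_iff:
  "realizes (M + N) f \<longleftrightarrow> (\<exists>g h. realizes M g \<and> realizes N h \<and> f = g + h)"
proof
  assume "realizes (M + N) f"
  then obtain A where A: "image_mset (\<lambda>(x, y). {x, y}) A = M + N"
    "f = (\<Sum>(x, y)\<in>#A. arc x y)" unfolding realizes_def by blast
  from image_mset_eq_plusD[OF A(1)] obtain B C where "A = B + C"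
    "M = image_mset (\<lambda>(x, y). {x, y}) B" "N = image_mset (\<lambda>(x, y). {x, y}) C" by blast
  then show "\<exists>g h. realizes M g \<and> realizes N h \<and> f = g + h"
    using A(2) unfolding realizes_def
    by (intro exI[of _ "\<Sum>(x, y)\<in>#B. arc x y"] exI[of _ "\<Sum>(x, y)\<in>#C. arc x y"]) auto
next
  assume "\<exists>g h. realizes M g \<and> realizes N h \<and> f = g + h"
  then obtain B C where "image_mset (\<lambda>(x, y). {x, y}) B = M" "image_mset (\<lambda>(x, y). {x, y}) C = N"
    "f = (\<Sum>(x, y)\<in>#B. arc x y) + (\<Sum>(x, y)\<in>#C. arc x y)" unfolding realizes_def by blast
  then show "realizes (M + N) f" unfolding realizes_def by (intro exI[of _ "B + C"]) simp
qed

text \<open>Used to force directions: at a vertex that the remaining edges miss, the edges already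
  peeled off must account for the whole prescribed value.\<close>

lemma realizes_support:
  assumes "realizes M f" "\<And>e. e \<in># M \<Longrightarrow> x \<notin> e"
  shows "f x = 0"
proof -
  obtain A where A: "image_mset (\<lambda>(x, y). {x, y}) A = M" "f = (\<Sum>(x, y)\<in>#A. arc x y)"
    using assms(1) unfolding realizes_def by blast
  have "\<forall>(y, z)\<in>#A. y \<noteq> x \<and> z \<noteq> x" using assms(2) A(1) by fastforce
  then have "(\<Sum>(x, y)\<in>#A. arc x y) x = 0"
    by (induction A) (auto simp: arc_def)
  then show ?thesis using A(2) by simp
qed

lemma realizes_exists:
  assumes "\<And>e. e \<in># M \<Longrightarrow> \<exists>x y. e = {x, y}"
  shows "\<exists>f. realizes M f"
  using assms
proof (induction M)
  case (add e M)
  then obtain x y f where "e = {x, y}" "realizes M f" by (metis insert_iff set_mset_add_mset_insert)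
  then have "realizes (add_mset e M) (f + arc x y)" by (simp add: realizes_add_iff)
  then show ?case by blast
qed auto

lemma realizes_in:
  assumes "realizes M f" "\<And>e. e \<in># M \<Longrightarrow> e \<subseteq> V" "finite V"
  shows "\<forall>p. p \<notin> V \<longrightarrow> f p = 0" "sum f V = 0"
proof -
  obtain A where A: "image_mset (\<lambda>(x, y). {x, y}) A = M" "f = (\<Sum>(x, y)\<in>#A. arc x y)"
    using assms(1) unfolding realizes_def by blast
  have "\<forall>(y, z)\<in>#A. y \<in> V \<and> z \<in> V" using assms(2) A(1) by fastforce
  then have "sum (\<Sum>(x, y)\<in>#A. arc x y) V = 0"
    by (induction A) (auto simp: sum.distrib sum_arc \<open>finite V\<close>)
  then show "sum f V = 0" using A(2) by simp
  show "\<forall>p. p \<notin> V \<longrightarrow> f p = 0" using realizes_support[OF assms(1)] assms(2) by blast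
qed

section \<open>Linked vertices\<close>

lemma linkedD: "linked M x y \<Longrightarrow> realizes M f \<Longrightarrow> realizes M (f + arc x y)"
  by (simp add: linked_def)

lemma linked_refl [simp]: "linked M x x"
  by (simp add: linked_def)

text \<open>Three copies of an arc cancel, so adding \<open>arc x y\<close> twice amounts to adding
  \<open>arc y x\<close>.\<close>

lemma linked_sym:
  assumes "linked M x y"
  shows "linked M y x"
  unfolding linked_def
proof (intro allI impI)
  fix f assume "realizes M f"
  then have "realizes M (f + arc x y + arc x y)" using linkedD[OF assms linkedD[OF assms]] by simp
  moreover have "f + arc x y + arc x y = f + arc y x"
    using fun_double[of "arc x y"] by (simp add: arc_flip[of y x] algebra_simps)
  ultimately show "realizes M (f + arc y x)" by simp
qed

lemma linked_trans:
  assumes "linked M x y" "linked M y z"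
  shows "linked M x z"
  unfolding linked_def
proof (intro allI impI)
  fix f assume "realizes M f"
  then have "realizes M (f + arc x y + arc y z)" using linkedD[OF assms(2) linkedD[OF assms(1)]] by simp
  then show "realizes M (f + arc x z)" by (simp add: arc_chain add.assoc)
qed

lemma linked_union:
  assumes "linked M x y"
  shows "linked (M + N) x y"
  unfolding linked_def
proof (intro allI impI)
  fix f assume "realizes (M + N) f"
  then obtain g h where gh: "realizes M g" "realizes N h" "f = g + h"
    unfolding realizes_union_iff by blast
  have "f + arc x y = (g + arc x y) + h" using gh(3) by (simp add: algebra_simps)
  then show "realizes (M + N) (f + arc x y)"
    unfolding realizes_union_iff using linkedD[OF assms gh(1)] gh(2) by blast
qed

lemma linked_mono: "linked M x y \<Longrightarrow> M \<subseteq># N \<Longrightarrow> linked N x y"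
  using linked_union[of M x y "N - M"] by simp

text \<open>Since \<open>M\<close> absorbs multiples of \<open>arc y z\<close>, the two new edges
  count as parallel edges with arc p. Together they contribute -2p, 0 or 2p, which modulo 3 are all
  multiples of p; hence another p can always be added.\<close>

lemma linked_attach:
  assumes "linked M y z"
  shows "linked (M + {#{x, y}, {x, z}#}) x y"
  unfolding linked_def
proof (intro allI impI)
  fix f assume "realizes (M + {#{x, y}, {x, z}#}) f"
  define p q where "p = arc x y" and "q = arc y z"
  have xz: "arc x z = p + q" by (simp add: p_def q_def arc_chain)
  have A: "2 * p = - p" "2 * q = - q" by (rule fun_double)+
  have R: "realizes (M + {#{x, y}, {x, z}#}) g \<longleftrightarrow>
      realizes M (g - p - (p + q)) \<or> realizes M (g - p + (p + q)) \<or>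
      realizes M (g + p - (p + q)) \<or> realizes M (g + p + (p + q))" for g
    using xz by (auto simp: realizes_add_iff p_def[symmetric])
  have up: "realizes M (g + q)" if "realizes M g" for g
    using linkedD[OF assms that] by (simp add: q_def)
  have down: "realizes M (g - q)" if "realizes M g" for g
  proof -
    have "g - q = g + q + q" using A by (simp add: algebra_simps)
    then show ?thesis using up[OF up[OF that]] by metis
  qed
  from \<open>realizes (M + _) f\<close>[unfolded R]
  consider "realizes M (f + p - q)" | "realizes M (f + q)" | "realizes M (f - q)" | "realizes M (f - p + q)"
  proof -
    have "f - p - (p + q) = f + p - q" "f + p + (p + q) = f - p + q" "f - p + (p + q) = f + q"
      "f + p - (p + q) = f - q"
      using A by (simp_all add: algebra_simps)
    with \<open>realizes (M + _) f\<close>[unfolded R] show thesis using that by metis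
  qed
  \<comment> \<open>Up to multiples of \<open>q\<close>, three orientations cover the three
    multiples of \<open>p\<close>; one of the two mixed orientations is enough.\<close>
  then have "realizes M (f + p + p + (p + q)) \<or> realizes M (f + p - p - (p + q)) \<or>
      realizes M (f + p - p + (p + q))"
  proof cases
    case 1
    from up[OF up[OF this]] have "realizes M (f + p - q + q + q)" .
    then show ?thesis using A by (simp add: algebra_simps)
  next
    case 2
    have "f + p + p + (p + q) = f + q" using A by (simp add: algebra_simps)
    then show ?thesis using 2 by simp
  next
    case 3
    from up[OF up[OF this]] have "realizes M (f - q + q + q)" .
    moreover have "f + p + p + (p + q) = f - q + q + q" using A by (simp add: algebra_simps)
    ultimately show ?thesis by simp
  next
    case 4
    from down[OF down[OF this]] have "realizes M (f - p + q - q - q)" .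
    moreover have "f + p - p - (p + q) = f - p + q - q - q" by (simp add: algebra_simps)
    ultimately show ?thesis by metis
  qed
  then show "realizes (M + {#{x, y}, {x, z}#}) (f + arc x y)"
    unfolding R p_def[symmetric] by blast
qed

lemma linked_double: "linked {#{x, y}, {x, y}#} x y"
  using linked_attach[of "{#}" y y x] by simp

text \<open>Every vertex is linked to \<open>y\<close>, the new one by \<open>linked_attach\<close>.
  The case \<open>y = z\<close> of two parallel edges is included.\<close>

lemma linked_new_vertex:
  assumes "\<And>p q. p \<in> W \<Longrightarrow> q \<in> W \<Longrightarrow> linked M p q" "y \<in> W" "z \<in> W"
    and "p \<in> insert x W" "q \<in> insert x W"
  shows "linked (M + {#{x, y}, {x, z}#}) p q"
proof -
  let ?N = "M + {#{x, y}, {x, z}#}"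
  have *: "linked ?N r y" if "r \<in> insert x W" for r
  proof (cases "r = x")
    case True
    then show ?thesis using linked_attach[OF assms(1)[OF assms(2,3)]] by simp
  next
    case False
    then show ?thesis using that assms(1)[OF _ assms(2)] by (intro linked_union) simp
  qed
  show ?thesis using linked_trans[OF *[OF assms(4)] linked_sym[OF *[OF assms(5)]]] .
qed


text \<open>An arbitrary orientation realizes some \<open>f0\<close>; the difference to the target
  has sum 0. Its values are pushed from vertex to vertex along linked pairs until the support is a
  single vertex, where the sum forces the value 0.\<close>

lemma Z3_con_if_linked:
  assumes "finite V" "\<And>e. e \<in># M \<Longrightarrow> e \<subseteq> V \<and> (\<exists>x y. e = {x, y})"
    and "\<And>x y. x \<in> V \<Longrightarrow> y \<in> V \<Longrightarrow> linked M x y"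
  shows "Z3_con V M"
  unfolding Z3_con_def
proof (intro allI impI)
  fix f :: "'a \<Rightarrow> 3"
  assume f: "\<forall>p. p \<notin> V \<longrightarrow> f p = 0" "sum f V = 0"
  have "\<exists>f0. realizes M f0" by (rule realizes_exists) (use assms(2) in simp)
  then obtain f0 where f0: "realizes M f0" ..
  note z = realizes_in[OF f0, of V]
  have *: "realizes M (g + h)" if "realizes M g" "finite S" "S \<subseteq> V" "\<forall>p. p \<notin> S \<longrightarrow> h p = 0" "sum h V = 0" for g h S
    using that(2,1,3-)
  proof (induction S arbitrary: g h rule: finite_induct)
    case empty
    then have "h = 0" by (simp add: fun_eq_iff)
    then show ?case using empty by simp
  next
    case (insert x S)
    show ?case
    proof (cases "S = {}")
      case True
      have "sum h V = sum h {x}" using insert.prems True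
        by (intro sum.mono_neutral_right) (auto simp: \<open>finite V\<close>)
      then have "h = 0" using insert.prems True by (auto simp: fun_eq_iff)
      then show ?thesis using insert by simp
    next
      case False
      then obtain y where y: "y \<in> S" by blast
      have L: "linked M x y" "linked M y x" using assms(3) insert.prems y by auto
      \<comment> \<open>\<open>c\<close> agrees with \<open>h\<close> at \<open>x\<close> and is
        supported on \<open>x\<close> and \<open>y\<close>: subtracting it moves the value of
        \<open>h\<close> from \<open>x\<close> to \<open>y\<close> and shrinks the support to
        \<open>S\<close>.\<close>
      obtain c where c: "realizes M (g + c)" "c x = h x" "\<forall>p. p \<notin> {x, y} \<longrightarrow> c p = 0" "sum c V = 0"
      proof (cases "h x" rule: three_cases)
        case 1
        then show ?thesis using that[of 0] insert.prems(1) by simp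
      next
        case 2
        have "realizes M (g + arc x y)" by (rule linkedD[OF L(1) insert.prems(1)])
        moreover have "arc x y x = h x" using 2 y insert.hyps by (auto simp: arc_def)
        moreover have "\<forall>p. p \<notin> {x, y} \<longrightarrow> arc x y p = 0" by (auto simp: arc_def)
        moreover have "sum (arc x y) V = 0" using insert.prems(2) y \<open>finite V\<close> by (intro sum_arc) auto
        ultimately show ?thesis using that by simp
      next
        case 3
        have "realizes M (g + arc y x)" by (rule linkedD[OF L(2) insert.prems(1)])
        moreover have "arc y x x = h x" using 3 y insert.hyps by (auto simp: arc_def)
        moreover have "\<forall>p. p \<notin> {x, y} \<longrightarrow> arc y x p = 0" by (auto simp: arc_def)
        moreover have "sum (arc y x) V = 0" using insert.prems(2) y \<open>finite V\<close> by (intro sum_arc) auto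
        ultimately show ?thesis using that by simp
      qed
      have "realizes M (g + c + (h - c))"
      proof (rule insert.IH[OF c(1)])
        show "\<forall>p. p \<notin> S \<longrightarrow> (h - c) p = 0"
        proof (intro allI impI)
          fix p assume "p \<notin> S"
          then show "(h - c) p = 0" using c insert.prems(3) y by (cases "p = x") auto
        qed
        show "sum (h - c) V = 0" using c insert.prems by (simp add: sum_subtractf)
      qed (use insert.prems in auto)
      moreover have "g + c + (h - c) = g + h" by (simp add: algebra_simps)
      ultimately show ?thesis by (simp only:)
    qed
  qed
  have "realizes M (f0 + (f - f0))"
    using *[OF f0 \<open>finite V\<close>, of "f - f0"] f z assms(1,2) by (simp add: sum_subtractf)
  moreover have "f0 + (f - f0) = f" by (simp add: algebra_simps)
  ultimately show "realizes M f" by (simp only:)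
qed

section \<open>Triangle-trees with a doubled edge\<close>

text \<open>
  A triangle-tree given by its vertex set and edge set, but with the construction started from a
  single edge: removing vertices from a triangle-tree may leave just that edge.
\<close>

inductive two_tree :: "'v set \<Rightarrow> 'v set set \<Rightarrow> bool" where
  edge: "x \<noteq> y \<Longrightarrow> two_tree {x, y} {{x, y}}"
| extend: "two_tree V E \<Longrightarrow> x \<notin> V \<Longrightarrow> {y, z} \<in> E \<Longrightarrow>
    two_tree (insert x V) (insert {x, y} (insert {x, z} E))"

lemma two_tree_edge: "two_tree V E \<Longrightarrow> e \<in> E \<Longrightarrow> e \<subseteq> V \<and> card e = 2"
proof (induction arbitrary: e rule: two_tree.induct)
  case (extend V E x y z)
  have "y \<in> V" "z \<in> V" using extend.IH[OF extend.hyps(3)] by auto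
  then have "card {x, y} = 2" "card {x, z} = 2" using extend.hyps(2) by (auto simp: card_2_iff)
  then show ?case using extend.prems extend.IH[of e] \<open>y \<in> V\<close> \<open>z \<in> V\<close> by auto
qed auto

lemma two_tree_edgeD: "two_tree V E \<Longrightarrow> {x, y} \<in> E \<Longrightarrow> x \<in> V \<and> y \<in> V \<and> x \<noteq> y"
  using two_tree_edge[of V E "{x, y}"] by (auto split: if_splits)

lemma two_tree_finite: "two_tree V E \<Longrightarrow> finite V \<and> finite E"
  by (induction rule: two_tree.induct) auto

lemma two_tree_card: "two_tree V E \<Longrightarrow> card V \<ge> 2"
  by (induction rule: two_tree.induct) (auto simp: card_insert_if dest: two_tree_finite)

text \<open>The tree may miss one edge if \<open>M\<close> links its ends. \<open>M\<close> is
  arbitrary because the induction shifts the missing edge: if it is one of the two edges at the last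
  vertex, the edge below that vertex takes over its role, and \<open>M\<close> grows by the edges
  spent on linking it.\<close>

lemma two_tree_linked:
  assumes "two_tree V E" "{a, b} \<in> E" "linked M a b" "p \<in> V" "q \<in> V"
  shows "linked (M + mset_set (E - {{a, b}})) p q"
  using assms
proof (induction arbitrary: a b M p q rule: two_tree.induct)
  case (edge x y)
  then have "{a, b} = {x, y}" by simp
  then have "linked M x y" using edge.prems(2) linked_sym[of M a b] by (auto simp: doubleton_eq_iff)
  then show ?case using edge.prems \<open>{a, b} = {x, y}\<close> linked_sym[of M x y] by auto
next
  case (extend V E x y z)
  note yz = two_tree_edgeD[OF extend.hyps(1,3)]
  have fin: "finite E" using two_tree_finite[OF extend.hyps(1)] by simp
  have new: "{x, c} \<notin> E" for c using two_tree_edgeD[OF extend.hyps(1)] extend.hyps(2) by blast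
  have xyz: "{x, y} \<noteq> {x, z}" using yz by (auto simp: doubleton_eq_iff)
  have key: "linked (M + mset_set (insert {x, c} (insert {x, d} E) - {{x, c}})) p q"
    if L: "linked M x c" and E: "{c, d} \<in> E" and cd: "{x, c} \<noteq> {x, d}"
      and pq: "p \<in> insert x V" "q \<in> insert x V" for c d M p q
  proof -
    note cdV = two_tree_edgeD[OF extend.hyps(1) E]
    let ?M = "M + {#{d, c}, {d, x}#}"
    \<comment> \<open>The edges \<open>dc\<close> and \<open>dx\<close> attach \<open>d\<close> to
      the linked pair \<open>c\<close>, \<open>x\<close>. So \<open>cd\<close> is spent on linking
      its own ends and becomes the missing edge of the smaller tree.\<close>
    have "linked ?M d c" using linked_attach[OF linked_sym[OF L]] .
    then have IH: "linked (?M + mset_set (E - {{c, d}})) p q" if "p \<in> V" "q \<in> V" for p q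
      using extend.IH[of c d ?M p q] linked_sym[of ?M d c] E that by simp
    have "mset_set E = add_mset {c, d} (mset_set (E - {{c, d}}))"
      using mset_set.remove[OF fin E] .
    then have eq: "?M + mset_set (E - {{c, d}}) = M + mset_set (insert {x, d} E)"
      using new fin by (simp add: insert_commute)
    have eq2: "insert {x, c} (insert {x, d} E) - {{x, c}} = insert {x, d} E"
      using new cd by auto
    have xc: "linked (M + mset_set (insert {x, d} E)) x c" using linked_union[OF L] .
    have *: "linked (M + mset_set (insert {x, d} E)) r c" if "r \<in> insert x V" for r
    proof (cases "r = x")
      case False
      then show ?thesis using IH[of r c] that cdV unfolding eq by simp
    qed (use xc in simp)
    show ?thesis unfolding eq2 using linked_trans[OF *[OF pq(1)] linked_sym[OF *[OF pq(2)]]] .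
  qed
  consider "{a, b} \<in> E" | c d where "c = x" "{a, b} = {c, d}" "d = y \<or> d = z"
    using extend.prems(1) by auto
  then show ?case
  proof cases
    case 1
    have IH: "linked (M + mset_set (E - {{a, b}})) p q" if "p \<in> V" "q \<in> V" for p q
      using extend.IH[OF 1 extend.prems(2) that] .
    have "{a, b} \<noteq> {x, y}" "{a, b} \<noteq> {x, z}" using new[of y] new[of z] 1 by metis+
    then have "insert {x, y} (insert {x, z} E) - {{a, b}} = insert {x, y} (insert {x, z} (E - {{a, b}}))"
      by auto
    moreover have "mset_set (insert {x, y} (insert {x, z} (E - {{a, b}}))) =
        mset_set (E - {{a, b}}) + {#{x, y}, {x, z}#}"
      using new fin xyz by (simp add: add_mset_commute)
    ultimately show ?thesis
      using linked_new_vertex[OF IH, of V y z p x q] yz extend.prems(3,4) by (simp add: add.assoc)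
  next
    case 2
    have "linked M x d" using 2 extend.prems(2) linked_sym[of M a b] by (auto simp: doubleton_eq_iff)
    note pq = extend.prems(3,4)
    show ?thesis
    proof (cases "d = y")
      case True
      show ?thesis
        using key[OF _ extend.hyps(3) xyz pq, of M] \<open>linked M x d\<close> 2(1,2) True by simp
    next
      case False
      then have d: "d = z" using 2(3) by simp
      have "{z, y} \<in> E" using extend.hyps(3) by (simp add: insert_commute)
      have "linked (M + mset_set (insert {x, z} (insert {x, y} E) - {{x, z}})) p q"
        using \<open>linked M x d\<close> xyz d by (intro key[OF _ \<open>{z, y} \<in> E\<close> _ pq]) auto
      moreover have "insert {x, z} (insert {x, y} E) - {{x, z}} = insert {x, y} (insert {x, z} E) - {{a, b}}"
        unfolding 2(2) 2(1) d by (rule arg_cong[of _ _ "\<lambda>S. S - _"]) (rule insert_commute)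
      ultimately show ?thesis by (simp only:)
    qed
  qed
qed

lemma mset_set_subseteq_mset: "E \<subseteq> set_mset M \<Longrightarrow> mset_set E \<subseteq># M"
  using subset_imp_msubset_mset_set[of E "set_mset M"] mset_set_set_mset_msubset[of M]
  by (metis finite_set_mset subset_mset.order_trans)

lemma two_tree_double_linked:
  assumes "two_tree V E" "{a, b} \<in> E" "add_mset {a, b} (mset_set E) \<subseteq># M" "p \<in> V" "q \<in> V"
  shows "linked M p q"
proof -
  have "mset_set E = add_mset {a, b} (mset_set (E - {{a, b}}))"
    using mset_set.remove[of E "{a, b}"] two_tree_finite[OF assms(1)] assms(2) by simp
  then have "{#{a, b}, {a, b}#} + mset_set (E - {{a, b}}) \<subseteq># M" using assms(3) by simp
  then show ?thesis
    using linked_mono[OF two_tree_linked[OF assms(1,2) linked_double assms(4,5)]] by blast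
qed

text \<open>Loops are excluded, although \<open>realizes\<close> admits them. In the bull lemmas
  only \<open>M\<close> is well-formed, not \<open>add_mset {a, b} M\<close>, so that
  \<open>a = b\<close> stays possible.\<close>

definition wf_pairs :: "'v set \<Rightarrow> 'v set multiset \<Rightarrow> bool" where
  "wf_pairs V M \<longleftrightarrow> finite V \<and> (\<forall>e\<in>#M. e \<subseteq> V \<and> card e = 2)"

lemma wf_pairs_linked_con:
  assumes "wf_pairs V M" "\<And>x y. x \<in> V \<Longrightarrow> y \<in> V \<Longrightarrow> linked M x y"
  shows "Z3_con V M"
proof (rule Z3_con_if_linked[OF _ _ assms(2)])
  fix e assume "e \<in># M"
  then have "e \<subseteq> V" "card e = 2" using assms(1) by (auto simp: wf_pairs_def)
  then show "e \<subseteq> V \<and> (\<exists>x y. e = {x, y})" unfolding card_2_iff by metis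
qed (use assms(1) in \<open>auto simp: wf_pairs_def\<close>)

lemma wf_pairs_double_con:
  assumes "wf_pairs V M" "two_tree V E" "{a, b} \<in> E" "add_mset {a, b} (mset_set E) \<subseteq># M"
  shows "Z3_con V M"
  using wf_pairs_linked_con[OF assms(1)] two_tree_double_linked[OF assms(2-4)] by blast

text \<open>An orientation of \<open>yz\<close> can be routed through \<open>x\<close>.\<close>

lemma realizes_lift:
  assumes "realizes (add_mset {y, z} M) f"
  shows "realizes (add_mset {x, y} (add_mset {x, z} M)) f"
proof -
  have yz: "arc y z = arc x z - arc x y" using arc_chain[of x y z] by (simp add: algebra_simps)
  have "f - arc y z = f - arc x z + arc x y" "f + arc y z = f + arc x z - arc x y"
    by (simp_all add: yz algebra_simps)
  then have "realizes M (f - arc x z + arc x y) \<or> realizes M (f + arc x z - arc x y)"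
    using assms by (simp only: realizes_add_iff)
  moreover have "f - arc x z + arc x y = f + arc x y - arc x z" "f + arc x z - arc x y = f - arc x y + arc x z"
    by (simp_all add: algebra_simps)
  ultimately show ?thesis by (simp only: realizes_add_iff) metis
qed

section \<open>Lifting, ears and bulls\<close>

lemma Z3_con_lift:
  "Z3_con V (add_mset {y, z} M) \<Longrightarrow> Z3_con V (add_mset {x, y} (add_mset {x, z} M))"
  unfolding Z3_con_def by (simp add: realizes_lift)

text \<open>Converse of \<open>wf_pairs_linked_con\<close>: adding an arc inside \<open>V\<close>
  keeps the support and the sum.\<close>

lemma Z3_con_linked:
  assumes "wf_pairs V M" "Z3_con V M" "x \<in> V" "y \<in> V"
  shows "linked M x y"
  unfolding linked_def
proof (intro allI impI)
  fix f assume f: "realizes M f"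
  have "finite V" "\<And>e. e \<in># M \<Longrightarrow> e \<subseteq> V" using assms(1) by (auto simp: wf_pairs_def)
  note in_V = realizes_in[OF f this(2,1)]
  have "arc x y p = 0" if "p \<notin> V" for p using that assms(3,4) by (auto simp: arc_def)
  then have "\<forall>p. p \<notin> V \<longrightarrow> (f + arc x y) p = 0" using in_V(1) by simp
  moreover have "sum (f + arc x y) V = 0"
    using in_V(2) sum_arc[OF \<open>finite V\<close> assms(3,4)] by (simp add: sum.distrib)
  ultimately show "realizes M (f + arc x y)" using assms(2) unfolding Z3_con_def by simp
qed

text \<open>From left to right, a suitable value at \<open>x\<close> leaves only one orientation of
  the two new edges, the other three being refuted by \<open>realizes_support\<close>. From right to
  left, \<open>x\<close> is a new vertex attached to a linked set.\<close>

lemma Z3_con_ear: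
  assumes "wf_pairs V M" "x \<notin> V" "y \<in> V" "z \<in> V"
  shows "Z3_con (insert x V) (M + {#{x, y}, {x, z}#}) \<longleftrightarrow> Z3_con V M"
proof
  have fin: "finite V" using assms(1) by (simp add: wf_pairs_def)
  have notin: "x \<notin> e" if "e \<in># M" for e using assms(1,2) that by (auto simp: wf_pairs_def)
  have xyz: "x \<noteq> y" "x \<noteq> z" using assms(2-4) by auto
  assume con: "Z3_con (insert x V) (M + {#{x, y}, {x, z}#})"
  show "Z3_con V M" unfolding Z3_con_def
  proof (intro allI impI)
    fix f :: "'a \<Rightarrow> 3" assume f: "\<forall>p. p \<notin> V \<longrightarrow> f p = 0" "sum f V = 0"
    \<comment> \<open>Both edges at \<open>x\<close> must point to \<open>x\<close> to realize the value \<open>- 2\<close> there.\<close>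
    define g where "g = f - arc x y - arc x z"
    have "g p = 0" if "p \<notin> insert x V" for p
      using that f(1) assms(3,4) by (auto simp: g_def arc_def)
    moreover have "sum g (insert x V) = 0"
      using f(2) f(1) assms(2-4) fin sum_arc[of "insert x V" x y] sum_arc[of "insert x V" x z]
      by (simp add: g_def sum_subtractf)
    ultimately have "realizes (M + {#{x, y}, {x, z}#}) g"
      using con unfolding Z3_con_def by blast
    moreover have "M + {#{x, y}, {x, z}#} = add_mset {x, y} (add_mset {x, z} M)" by simp
    ultimately have "realizes (add_mset {x, y} (add_mset {x, z} M)) g" by (simp only:)
    then consider "realizes M (g - arc x y - arc x z)" | "realizes M (g - arc x y + arc x z)"
      | "realizes M (g + arc x y - arc x z)" | "realizes M (g + arc x y + arc x z)"
      unfolding realizes_add_iff by fast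
    then show "realizes M f"
    proof cases
      case 4
      moreover have "g + arc x y + arc x z = f" by (simp add: g_def)
      ultimately show ?thesis by (simp only:)
    qed (use realizes_support[OF _ notin] assms(2) f(1) xyz in \<open>fastforce simp: g_def arc_def\<close>)+
  qed
next
  assume "Z3_con V M"
  then have L: "linked M p q" if "p \<in> V" "q \<in> V" for p q using Z3_con_linked[OF assms(1) _ that] by simp
  show "Z3_con (insert x V) (M + {#{x, y}, {x, z}#})"
  proof (rule wf_pairs_linked_con)
    show "wf_pairs (insert x V) (M + {#{x, y}, {x, z}#})"
      using assms by (auto simp: wf_pairs_def card_insert_if)
  qed (use linked_new_vertex[OF L assms(3,4)] in simp)
qed

text \<open>Directions become scalars, so that those of several peeled edges can be compared by
  arithmetic in Z/3.\<close>

lemma realizes_addE: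
  assumes "realizes (add_mset {x, y} M) f"
  obtains s where "s = 1 \<or> s = -1" "realizes M (\<lambda>p. f p - s * arc x y p)"
proof -
  have "f - arc x y = (\<lambda>p. f p - 1 * arc x y p)" "f + arc x y = (\<lambda>p. f p - (-1) * arc x y p)"
    by (simp_all add: fun_eq_iff)
  then show thesis using assms that unfolding realizes_add_iff by metis
qed

text \<open>As integers, three signs add up to 1, -1, 3 or -3. Thus a vertex of degree 3 with value
  0 is a source or a sink.\<close>

lemma two_signs_three:
  fixes r s t :: 3
  assumes "r = 1 \<or> r = -1" "s = 1 \<or> s = -1" "t = 1 \<or> t = -1" "r + s + t = 0"
  shows "s = r \<and> t = r"
  using assms by auto

text \<open>With value 0 at \<open>u\<close> and \<open>v\<close>, each of them is a source or a
  sink, and the edge \<open>uv\<close> makes one a source and the other a sink. Then the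
  contributions at \<open>w\<close> cancel, and the five edges act like one edge between
  \<open>a\<close> and \<open>b\<close>.\<close>

lemma Z3_con_bullD:
  assumes wf: "wf_pairs V M" and uv: "u \<notin> V" "v \<notin> V" "u \<noteq> v" and wab: "w \<in> V" "a \<in> V" "b \<in> V"
    and con: "Z3_con (insert u (insert v V)) (M + {#{u, v}, {u, w}, {u, a}, {v, w}, {v, b}#})"
  shows "Z3_con V (add_mset {a, b} M)"
  unfolding Z3_con_def
proof (intro allI impI)
  have fin: "finite V" using wf by (simp add: wf_pairs_def)
  have notin: "u \<notin> e" "v \<notin> e" if "e \<in># M" for e using wf uv that by (auto simp: wf_pairs_def)
  have ne: "u \<noteq> w" "u \<noteq> a" "u \<noteq> b" "v \<noteq> w" "v \<noteq> a" "v \<noteq> b" using uv wab by auto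
  fix f :: "'a \<Rightarrow> 3" assume f: "\<forall>p. p \<notin> V \<longrightarrow> f p = 0" "sum f V = 0"
  have "sum f (insert u (insert v V)) = 0" using f uv fin by simp
  then have "realizes (M + {#{u, v}, {u, w}, {u, a}, {v, w}, {v, b}#}) f"
    using con f(1) unfolding Z3_con_def by blast
  then have "realizes (add_mset {u, v} (add_mset {u, w} (add_mset {u, a}
      (add_mset {v, w} (add_mset {v, b} M))))) f" by simp
  then obtain s1 s2 s3 s4 s5 where s: "s1 = 1 \<or> s1 = -1" "s2 = 1 \<or> s2 = -1" "s3 = 1 \<or> s3 = -1"
      "s4 = 1 \<or> s4 = -1" "s5 = 1 \<or> s5 = -1"
    and R: "realizes M (\<lambda>p. f p - s1 * arc u v p - s2 * arc u w p - s3 * arc u a p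
      - s4 * arc v w p - s5 * arc v b p)" (is "realizes M ?g")
    by (elim realizes_addE)
  have g: "?g u = 0" "?g v = 0" using realizes_support[OF R notin(1)] realizes_support[OF R notin(2)] by auto
  have "s1 + s2 + s3 = - ?g u"
    using f(1) uv ne by (simp add: arc_def)
  then have "s1 + s2 + s3 = 0" unfolding g by simp
  then have 1: "s2 = s1" "s3 = s1" using two_signs_three[OF s(1,2,3)] by auto
  have "(- s1) + s4 + s5 = - ?g v"
    using f(1) uv ne by (simp add: arc_def)
  then have "(- s1) + s4 + s5 = 0" unfolding g by simp
  then have 2: "s4 = - s1" "s5 = - s1" using two_signs_three[OF _ s(4,5), of "- s1"] s(1) by auto
  have "?g p = f p - s1 * arc b a p" for p
  proof -
    \<comment> \<open>At \<open>u\<close> and \<open>v\<close> the coefficients are 3 and -3, at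
      \<open>w\<close> they cancel.\<close>
    have *: "arc b a p = arc u v p + arc u w p + arc u a p - arc v w p - arc v b p"
      unfolding arc_def by (simp add: algebra_simps)
    show ?thesis unfolding 1 2 * by (simp add: algebra_simps)
  qed
  then have "realizes M (\<lambda>p. f p - s1 * arc b a p)" using R by (simp only:)
  moreover have "(\<lambda>p. f p - 1 * arc b a p) = f - arc b a" "(\<lambda>p. f p - (-1) * arc b a p) = f + arc b a"
    by (simp_all add: fun_eq_iff)
  ultimately have "realizes (add_mset {b, a} M) f" using s(1) unfolding realizes_add_iff by metis
  then show "realizes (add_mset {a, b} M) f" by (simp add: insert_commute)
qed

text \<open>If both values at \<open>u\<close> and \<open>v\<close> are 0, the argument of
  \<open>Z3_con_bullD\<close> is reversible, and only then is \<open>con\<close> used. Otherwise the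
  spanning tree alone suffices; the condition \<open>{w, b} \<in> E\<close> ensures that the lifted
  edge is parallel to a tree edge.\<close>

lemma Z3_con_bullI:
  assumes wf: "wf_pairs V M" and uv: "u \<notin> V" "v \<notin> V" "u \<noteq> v" and wab: "w \<in> V" "a \<in> V" "b \<in> V"
    and T: "two_tree V E" "E \<subseteq> set_mset M" "{w, b} \<in> E"
    and con: "Z3_con V (add_mset {a, b} M)"
  shows "Z3_con (insert u (insert v V)) (M + {#{u, v}, {u, w}, {u, a}, {v, w}, {v, b}#})"
  unfolding Z3_con_def
proof (intro allI impI)
  have fin: "finite V" using wf by (simp add: wf_pairs_def)
  have ne: "u \<noteq> w" "u \<noteq> a" "u \<noteq> b" "v \<noteq> w" "v \<noteq> a" "v \<noteq> b" using uv wab by auto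
  have wb: "w \<noteq> b" using two_tree_edgeD[OF T(1,3)] by simp
  have E: "mset_set E \<subseteq># M" by (rule mset_set_subseteq_mset[OF T(2)])
  have new: "{v, w} \<notin> E" "{v, b} \<notin> E" using two_tree_edgeD[OF T(1)] uv(2) by blast+
  fix f :: "'a \<Rightarrow> 3"
  assume f: "\<forall>p. p \<notin> insert u (insert v V) \<longrightarrow> f p = 0" "sum f (insert u (insert v V)) = 0"
  let ?S = "{#{u, v}, {u, w}, {u, a}, {v, w}, {v, b}#}"
  \<comment> \<open>The edge \<open>xy\<close> alone takes care of \<open>x\<close>: a nonzero value
    is 1 or -1 and dictates its direction, and what remains is a boundary on
    \<open>W\<close>.\<close>
  have reduce: "realizes (add_mset {x, y} N) f"
    if "x \<notin> W" "y \<in> W" "insert x W = insert u (insert v V)" "f x \<noteq> 0" "Z3_con W N" for x y W N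
  proof -
    have finW: "finite W" using that(3) fin by (metis finite_insert)
    have *: "realizes N (\<lambda>p. f p - s * arc x y p)" if s: "f x = s" for s
    proof -
      have z: "f p - s * arc x y p = 0" if "p \<notin> W" for p
        using that s f(1) \<open>x \<notin> W\<close> \<open>y \<in> W\<close> \<open>insert x W = _\<close>[symmetric] by (cases "p = x") (auto simp: arc_def)
      have "(\<Sum>p\<in>insert x W. f p - s * arc x y p) = 0"
        using f(2) sum_arc[of "insert x W" x y] \<open>insert x W = _\<close>[symmetric] finW \<open>y \<in> W\<close>
        by (simp only: sum_subtractf sum_distrib_left[symmetric]) simp
      moreover have "arc x y x = 1" using \<open>x \<notin> W\<close> \<open>y \<in> W\<close> by (auto simp: arc_def)
      ultimately have "(\<Sum>p\<in>W. f p - s * arc x y p) = 0"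
        using s finW \<open>x \<notin> W\<close> by simp
      then show ?thesis
        using \<open>Z3_con W N\<close>[unfolded Z3_con_def, rule_format, of "\<lambda>p. f p - s * arc x y p"] z by simp
    qed
    have "(\<lambda>p. f p - 1 * arc x y p) = f - arc x y" "(\<lambda>p. f p - (-1) * arc x y p) = f + arc x y"
      by (simp_all add: fun_eq_iff)
    then show ?thesis using *[OF refl] that(4) unfolding realizes_add_iff
      by (cases "f x" rule: three_cases) auto
  qed
  consider "f v \<noteq> 0" | "f u \<noteq> 0" | "f u = 0" "f v = 0" by blast
  then show "realizes (M + ?S) f"
  proof cases
    case 1
    \<comment> \<open>Lift the edges \<open>vw\<close> and \<open>vb\<close>: this doubles the tree edge \<open>wb\<close>.\<close>
    have "Z3_con V (add_mset {w, b} M)"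
      using wf wab wb E by (intro wf_pairs_double_con[OF _ T(1,3)]) (auto simp: wf_pairs_def)
    then have "Z3_con (insert u V) (add_mset {w, b} M + {#{u, w}, {u, a}#})"
      using wf wab wb uv by (subst Z3_con_ear) (auto simp: wf_pairs_def)
    then have "realizes (add_mset {v, u} (add_mset {w, b} M + {#{u, w}, {u, a}#})) f"
      using uv 1 by (intro reduce[of v "insert u V"]) auto
    then have "realizes (add_mset {w, b} (M + {#{v, u}, {u, w}, {u, a}#})) f"
      by (simp add: add_mset_commute)
    from realizes_lift[OF this, of v] show ?thesis
      by (simp add: add_mset_commute insert_commute)
  next
    case 2
    \<comment> \<open>Lift the edges \<open>uv\<close> and \<open>uw\<close>: this doubles the tree edge \<open>vw\<close>.\<close>
    let ?N = "M + {#{v, w}, {v, w}, {v, b}#}"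
    have "Z3_con (insert v V) ?N"
    proof (rule wf_pairs_double_con)
      show "wf_pairs (insert v V) ?N" using wf wab uv ne by (auto simp: wf_pairs_def)
      show "two_tree (insert v V) (insert {v, w} (insert {v, b} E))"
        by (rule two_tree.extend[OF T(1) uv(2) T(3)])
      show "{v, w} \<in> insert {v, w} (insert {v, b} E)" by simp
      show "add_mset {v, w} (mset_set (insert {v, w} (insert {v, b} E))) \<subseteq># ?N"
        using E new wb two_tree_finite[OF T(1)] by (simp add: doubleton_eq_iff)
    qed
    then have "realizes (add_mset {u, a} ?N) f"
      using uv 2 wab by (intro reduce[of u "insert v V"]) auto
    then have "realizes (add_mset {v, w} (M + {#{u, a}, {v, w}, {v, b}#})) f"
      by (simp add: add_mset_commute)
    from realizes_lift[OF this, of u] show ?thesis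
      by (simp add: add_mset_commute insert_commute)
  next
    case 3
    \<comment> \<open>An orientation of \<open>ab\<close> tells which of \<open>u\<close>, \<open>v\<close> becomes a source and which a sink.\<close>
    have "sum f V = 0" using f(2) 3 uv fin by simp
    moreover have "\<forall>p. p \<notin> V \<longrightarrow> f p = 0" using f(1) 3 by auto
    ultimately have "realizes (add_mset {a, b} M) f" using con unfolding Z3_con_def by blast
    then obtain s where s: "s = 1 \<or> s = -1" "realizes M (\<lambda>p. f p - s * arc a b p)"
      by (elim realizes_addE)
    have addI: "realizes (add_mset {x, y} N) g"
      if "r = 1 \<or> r = -1" "realizes N (\<lambda>p. g p - r * arc x y p)" for r x y N and g :: "'a \<Rightarrow> 3"
    proof -
      have "(\<lambda>p. g p - 1 * arc x y p) = g - arc x y" "(\<lambda>p. g p - (-1) * arc x y p) = g + arc x y"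
        by (simp_all add: fun_eq_iff)
      then show ?thesis using that unfolding realizes_add_iff by metis
    qed
    have "f p - s * arc a b p = f p - (- s) * arc u v p - (- s) * arc u w p - (- s) * arc u a p
        - s * arc v w p - s * arc v b p" for p
    proof -
      have *: "arc a b p = arc v w p + arc v b p - arc u v p - arc u w p - arc u a p"
        unfolding arc_def by (simp add: algebra_simps)
      show ?thesis unfolding * by (simp add: algebra_simps)
    qed
    then have "realizes M (\<lambda>p. f p - (- s) * arc u v p - (- s) * arc u w p - (- s) * arc u a p
        - s * arc v w p - s * arc v b p)" using s(2) by (simp only:)
    then have "realizes (add_mset {u, v} (add_mset {u, w} (add_mset {u, a}
        (add_mset {v, w} (add_mset {v, b} M))))) f"
      using s(1) by (intro addI[of "- s"] addI[of s]) auto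
    then show ?thesis by simp
  qed
qed

section \<open>Decomposition of triangle-trees\<close>

text \<open>
  The edges of a triangle-tree \<open>E0\<close> extended by a vertex \<open>v\<close> on its edge \<open>wb\<close> and then by the
  vertices \<open>u \<in> L\<close>, each on the edge from \<open>v\<close> to \<open>g u\<close>, where \<open>g u\<close> is \<open>w\<close> or \<open>b\<close>.
\<close>

definition fan_edges :: "'v set set \<Rightarrow> 'v \<Rightarrow> 'v \<Rightarrow> 'v \<Rightarrow> ('v \<Rightarrow> 'v) \<Rightarrow> 'v set \<Rightarrow> 'v set set" where
  "fan_edges E0 v w b g L = E0 \<union> {{v, w}, {v, b}} \<union> (\<Union>u\<in>L. {{u, v}, {u, g u}})"

definition is_fan :: "'v set \<Rightarrow> 'v set set \<Rightarrow> 'v \<Rightarrow> 'v \<Rightarrow> 'v \<Rightarrow> ('v \<Rightarrow> 'v) \<Rightarrow> 'v set \<Rightarrow> bool" where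
  "is_fan V0 E0 v w b g L \<longleftrightarrow> two_tree V0 E0 \<and> {w, b} \<in> E0 \<and> v \<notin> V0 \<and> finite L \<and>
     L \<inter> insert v V0 = {} \<and> g ` L \<subseteq> {w, b}"

lemma is_fan_two_tree:
  assumes "is_fan V0 E0 v w b g L"
  shows "two_tree (insert v V0 \<union> L) (fan_edges E0 v w b g L)"
proof -
  have *: "two_tree V0 E0" "{w, b} \<in> E0" "v \<notin> V0" using assms by (auto simp: is_fan_def)
  have "finite L" "L \<inter> insert v V0 = {}" "g ` L \<subseteq> {w, b}" using assms by (auto simp: is_fan_def)
  then show ?thesis
  proof (induction L rule: finite_induct)
    case empty
    show ?case using two_tree.extend[OF *(1,3,2)] by (simp add: fan_edges_def insert_commute)
  next
    case (insert u L)
    have "{v, g u} \<in> fan_edges E0 v w b g L" using insert.prems by (auto simp: fan_edges_def)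
    moreover have "u \<notin> insert v V0 \<union> L" using insert by auto
    moreover have "two_tree (insert v V0 \<union> L) (fan_edges E0 v w b g L)"
      using insert by auto
    ultimately have "two_tree (insert u (insert v V0 \<union> L))
        (insert {u, v} (insert {u, g u} (fan_edges E0 v w b g L)))"
      by (intro two_tree.extend)
    moreover have "insert {u, v} (insert {u, g u} (fan_edges E0 v w b g L)) = fan_edges E0 v w b g (insert u L)"
      unfolding fan_edges_def by blast
    moreover have "insert u (insert v V0 \<union> L) = insert v V0 \<union> insert u L" by blast
    ultimately show ?case by (simp only:)
  qed
qed

text \<open>Leaves do not depend on each other, so any set of them can be removed and a tree
  remains.\<close>

lemma is_fan_subset: "is_fan V0 E0 v w b g L \<Longrightarrow> K \<subseteq> L \<Longrightarrow> is_fan V0 E0 v w b g K"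
  unfolding is_fan_def by (auto intro: finite_subset)

lemma two_tree_triangle:
  assumes "two_tree V E" "card V = 3" "{y, z} \<in> E"
  obtains t where "t \<noteq> y" "t \<noteq> z" "y \<noteq> z" "V = {y, z, t}" "E = {{y, z}, {y, t}, {z, t}}"
proof -
  from assms(1) obtain c p q where c: "c \<noteq> p" "c \<noteq> q" "p \<noteq> q" "V = {c, p, q}" "E = {{c, p}, {c, q}, {p, q}}"
  proof cases
    case (edge x y)
    then show thesis using assms(2) by simp
  next
    case (extend V' E' x y z)
    then have "card V' = 2" using assms(2) two_tree_finite[of V' E'] by simp
    from extend(3) show thesis
    proof cases
      case (edge p q)
      then have "{y, z} = {p, q}" using extend(5) by simp
      then have "{{x, y}, {x, z}} = {{x, p}, {x, q}}" by (auto simp: doubleton_eq_iff)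
      then have "E = {{x, p}, {x, q}, {p, q}}" using extend(2) edge(2) by (simp add: insert_commute)
      then show thesis using that[of x p q] extend(1,4) edge by auto
    next
      case (extend V'' E'' x' y' z')
      then show thesis using \<open>card V' = 2\<close> two_tree_finite[of V'' E''] two_tree_card[of V'' E''] by simp
    qed
  qed
  from c(5) assms(3) consider "{y, z} = {c, p}" | "{y, z} = {c, q}" | "{y, z} = {p, q}" by auto
  then show thesis
  proof cases
    case 1
    then show ?thesis using that[of q] c by (auto simp: doubleton_eq_iff insert_commute)
  next
    case 2
    then show ?thesis using that[of p] c by (auto simp: doubleton_eq_iff insert_commute)
  next
    case 3
    then show ?thesis using that[of c] c by (auto simp: doubleton_eq_iff insert_commute)
  qed
qed

text \<open>Induction on the construction. A new vertex on an edge of the core enlarges the core,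
  one on \<open>vw\<close> or \<open>vb\<close> is a further leaf, and one on an edge at a leaf
  turns that leaf into the centre of a new fan.\<close>

lemma two_tree_fan:
  assumes "two_tree V E" "card V \<ge> 4"
  shows "\<exists>V0 E0 v w b g L. is_fan V0 E0 v w b g L \<and> L \<noteq> {} \<and> V = insert v V0 \<union> L \<and>
    E = fan_edges E0 v w b g L"
  using assms
proof (induction rule: two_tree.induct)
  case (edge x y)
  then show ?case by simp
next
  case (extend V E x y z)
  note fin = two_tree_finite[OF extend.hyps(1)]
  note yz = two_tree_edgeD[OF extend.hyps(1,3)]
  have card: "card V \<ge> 3" using extend.prems extend.hyps(2) fin by simp
  show ?case
  proof (cases "card V = 3")
    case True
    then obtain t where t: "t \<noteq> y" "t \<noteq> z" "y \<noteq> z" "V = {y, z, t}" "E = {{y, z}, {y, t}, {z, t}}"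
      using two_tree_triangle[OF extend.hyps(1) _ extend.hyps(3)] by metis
    \<comment> \<open>The centre is \<open>z\<close>, one end of the edge that carries
      \<open>x\<close>; the core is the side of the triangle opposite to it.\<close>
    have "is_fan {y, t} {{y, t}} z y t (\<lambda>_. y) {x}"
      using t extend.hyps(2) by (auto simp: is_fan_def intro: two_tree.edge)
    moreover have "insert x V = insert z {y, t} \<union> {x}" using t by auto
    moreover have "insert {x, y} (insert {x, z} E) = fan_edges {{y, t}} z y t (\<lambda>_. y) {x}"
      unfolding t(5) fan_edges_def by (auto simp: insert_commute)
    ultimately show ?thesis by blast
  next
    case False
    then have "card V \<ge> 4" using card by simp
    from extend.IH[OF this] obtain V0 E0 v w b g L where F: "is_fan V0 E0 v w b g L" and L: "L \<noteq> {}"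
      and V: "V = insert v V0 \<union> L" and E: "E = fan_edges E0 v w b g L"
      by metis
    note F' = F[unfolded is_fan_def]
    have xV: "x \<notin> insert v V0" "x \<notin> L" using extend.hyps(2) V by auto
    have wb: "w \<in> V0" "b \<in> V0" using two_tree_edgeD[of V0 E0 w b] F' by auto
    consider "{y, z} \<in> E0"
      | d where "d = w \<or> d = b" "{y, z} = {v, d}"
      | u d where "u \<in> L" "d = v \<or> d = g u" "{y, z} = {u, d}"
      using extend.hyps(3) unfolding E fan_edges_def by blast
    then show ?thesis
    proof cases
      case 1
      have "is_fan (insert x V0) (insert {x, y} (insert {x, z} E0)) v w b g L"
        using F' xV two_tree.extend[of V0 E0 x y z] 1 by (auto simp: is_fan_def)
      moreover have "insert x V = insert v (insert x V0) \<union> L" using V by auto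
      moreover have "insert {x, y} (insert {x, z} E) =
          fan_edges (insert {x, y} (insert {x, z} E0)) v w b g L" unfolding E fan_edges_def by blast
      ultimately show ?thesis using L by blast
    next
      case 2
      let ?g = "g(x := d)"
      have "is_fan V0 E0 v w b ?g (insert x L)"
        using F' xV 2(1) by (auto simp: is_fan_def image_subset_iff)
      moreover have "insert x V = insert v V0 \<union> insert x L" using V by auto
      moreover have "insert {x, y} (insert {x, z} E) = fan_edges E0 v w b ?g (insert x L)"
      proof -
        have "(\<Union>u\<in>L. {{u, v}, {u, ?g u}}) = (\<Union>u\<in>L. {{u, v}, {u, g u}})"
          by (rule SUP_cong) (use xV(2) in auto)
        then have U: "(\<Union>u\<in>insert x L. {{u, v}, {u, ?g u}}) = {{x, v}, {x, d}} \<union> (\<Union>u\<in>L. {{u, v}, {u, g u}})"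
          unfolding UN_insert by simp
        have "{{x, y}, {x, z}} = {{x, v}, {x, d}}" using 2(2) by (auto simp: doubleton_eq_iff)
        moreover have "insert {x, y} (insert {x, z} E) = {{x, y}, {x, z}} \<union> E" by simp
        ultimately have "insert {x, y} (insert {x, z} E) = {{x, v}, {x, d}} \<union> E" by (simp only:)
        then show ?thesis unfolding E fan_edges_def U by (simp only: Un_ac)
      qed
      ultimately show ?thesis by blast
    next
      case 3
      \<comment> \<open>The leaf \<open>u\<close> becomes the centre over the base edge from
        \<open>v\<close> to \<open>g u\<close>; \<open>v\<close> and the other leaves join the
        core.\<close>
      let ?K = "L - {u}"
      have gu: "g u = w \<or> g u = b" using F' 3(1) by auto
      have "{v, g u} \<in> fan_edges E0 v w b g ?K" using gu by (auto simp: fan_edges_def)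
      moreover have "u \<notin> insert v V0 \<union> ?K" using F' 3(1) by auto
      moreover have "{x} \<inter> insert u (insert v V0 \<union> ?K) = {}" using xV 3(1) by auto
      ultimately have "is_fan (insert v V0 \<union> ?K) (fan_edges E0 v w b g ?K) u v (g u) (\<lambda>_. d) {x}"
        using is_fan_two_tree[OF is_fan_subset[OF F, of ?K]] 3(2) by (auto simp: is_fan_def)
      moreover have "insert x V = insert u (insert v V0 \<union> ?K) \<union> {x}" using V 3(1) by auto
      moreover have "insert {x, y} (insert {x, z} E) =
          fan_edges (fan_edges E0 v w b g ?K) u v (g u) (\<lambda>_. d) {x}"
      proof -
        have "{{x, y}, {x, z}} = {{x, u}, {x, d}}" using 3(3) by (auto simp: doubleton_eq_iff)
        moreover have "insert {x, y} (insert {x, z} E) = {{x, y}, {x, z}} \<union> E" by simp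
        ultimately have "insert {x, y} (insert {x, z} E) = {{x, u}, {x, d}} \<union> E" by (simp only:)
        moreover have "E = {{u, v}, {u, g u}} \<union> fan_edges E0 v w b g ?K"
        proof -
          have "insert u ?K = L" using 3(1) by blast
          then have "(\<Union>t\<in>L. {{t, v}, {t, g t}}) = {{u, v}, {u, g u}} \<union> (\<Union>t\<in>?K. {{t, v}, {t, g t}})"
            using UN_insert[of "\<lambda>t. {{t, v}, {t, g t}}" u ?K] by (simp only:)
          then show ?thesis unfolding E fan_edges_def by (simp only: Un_ac)
        qed
        ultimately show ?thesis unfolding fan_edges_def[of "fan_edges E0 v w b g ?K"] by (simp add: Un_ac)
      qed
      ultimately show ?thesis by blast
    qed
  qed
qed

section \<open>Reducible configurations\<close>

definition star :: "'v set multiset \<Rightarrow> 'v \<Rightarrow> 'v set multiset" where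
  "star M x = {#e \<in># M. x \<in> e#}"

definition del :: "'v set multiset \<Rightarrow> 'v set \<Rightarrow> 'v set multiset" where
  "del M S = {#e \<in># M. e \<inter> S = {}#}"

text \<open>The bound 4, like 5 for bulls, leaves at least three vertices, so that \<open>E\<close>
  is a genuine triangle-tree of the reduced graph. The edge \<open>yz\<close> becomes the common
  edge of the 2-sum.\<close>

definition ear_reducible :: "'v set \<Rightarrow> 'v set multiset \<Rightarrow> bool" where
  "ear_reducible V M \<longleftrightarrow> (\<exists>x y z E. x \<in> V \<and> star M x = {#{x, y}, {x, z}#} \<and> {y, z} \<in> E \<and>
     two_tree (V - {x}) E \<and> E \<subseteq> set_mset M \<and> card V \<ge> 4 \<and> \<not> Z3_con (V - {x}) (del M {x}))"

definition bull_reducible :: "'v set \<Rightarrow> 'v set multiset \<Rightarrow> bool" where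
  "bull_reducible V M \<longleftrightarrow> (\<exists>u v w a b E. u \<in> V \<and> v \<in> V \<and> w \<in> V - {u, v} \<and> a \<in> V - {u, v, w} \<and>
     b \<in> V - {u, v, w} \<and> star M u = {#{u, v}, {u, w}, {u, a}#} \<and> star M v = {#{u, v}, {v, w}, {v, b}#} \<and>
     two_tree (V - {u, v}) E \<and> E \<subseteq> set_mset M \<and> card V \<ge> 5 \<and>
     \<not> Z3_con (V - {u, v}) (add_mset {a, b} (del M {u, v})))"

lemma del_star: "M = del M {x} + star M x"
proof -
  have "del M {x} = {#e \<in># M. x \<notin> e#}" by (simp add: del_def)
  then show ?thesis unfolding star_def by (metis multiset_partition add.commute)
qed

lemma wf_pairs_del: "wf_pairs V M \<Longrightarrow> wf_pairs (V - S) (del M S)"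
  by (auto simp: wf_pairs_def del_def)

lemma two_tree_subset_del:
  "two_tree (V - S) E \<Longrightarrow> E \<subseteq> set_mset M \<Longrightarrow> E \<subseteq> set_mset (del M S)"
  using two_tree_edge by (fastforce simp: del_def)

text \<open>The edge \<open>uv\<close> lies in both stars; deleting \<open>u\<close> first leaves
  only \<open>vw\<close> and \<open>vb\<close> at \<open>v\<close>, so it is counted once.\<close>

lemma bull_stars:
  assumes "u \<noteq> v" "w \<notin> {u, v}" "a \<notin> {u, v}" "b \<notin> {u, v}"
    and "star M u = {#{u, v}, {u, w}, {u, a}#}" "star M v = {#{u, v}, {v, w}, {v, b}#}"
  shows "M = del M {u, v} + {#{u, v}, {u, w}, {u, a}, {v, w}, {v, b}#}"
proof -
  have "del (del M {u}) {v} = del M {u, v}"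
    by (auto simp: del_def filter_filter_mset intro!: filter_mset_cong)
  then have 1: "del M {u} = del M {u, v} + star (del M {u}) v"
    using del_star[of "del M {u}" v] by simp
  have "star (del M {u}) v = filter_mset (\<lambda>e. u \<notin> e) (star M v)"
    by (auto simp: star_def del_def filter_filter_mset intro!: filter_mset_cong)
  also have "\<dots> = {#{v, w}, {v, b}#}" unfolding assms(6) using assms(1-4) by auto
  finally show ?thesis using del_star[of M u] 1 assms(5) by (simp add: add_mset_commute)
qed

text \<open>The roles of \<open>u\<close> and \<open>v\<close> differ: \<open>w\<close> and the
  third neighbour \<open>b\<close> of \<open>v\<close> must span a tree edge, while the third
  neighbour \<open>a\<close> of \<open>u\<close> is arbitrary.\<close>

lemma bull_reducibleI:
  assumes wf: "wf_pairs V M" and nc: "\<not> Z3_con V M" and card: "card V \<ge> 5"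
    and V: "u \<in> V" "v \<in> V" "u \<noteq> v" "w \<in> V - {u, v}" "a \<in> V - {u, v, w}" "b \<in> V - {u, v, w}"
    and S: "star M u = {#{u, v}, {u, w}, {u, a}#}" "star M v = {#{u, v}, {v, w}, {v, b}#}"
    and T: "two_tree (V - {u, v}) E" "E \<subseteq> set_mset M" "{w, b} \<in> E"
  shows "bull_reducible V M"
proof -
  have M: "M = del M {u, v} + {#{u, v}, {u, w}, {u, a}, {v, w}, {v, b}#}"
    using V by (intro bull_stars[OF _ _ _ _ S]) auto
  have "insert u (insert v (V - {u, v})) = V" using V by auto
  then have "\<not> Z3_con (V - {u, v}) (add_mset {a, b} (del M {u, v}))"
    using Z3_con_bullI[OF wf_pairs_del[OF wf, of "{u, v}"], of u v w a b E]
      two_tree_subset_del[OF T(1,2)] V T nc M by auto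
  then show ?thesis unfolding bull_reducible_def using V S T card by blast
qed

lemma double_edge_con:
  assumes "wf_pairs V M" "two_tree V E" "E \<subseteq> set_mset M" "e \<in> E" "count M e \<ge> 2"
  shows "Z3_con V M"
proof -
  obtain x y where e: "e = {x, y}" using two_tree_edge[OF assms(2,4)] by (auto simp: card_2_iff)
  have "count (add_mset e (mset_set E)) f \<le> count M f" for f
    using assms(3-5) two_tree_finite[OF assms(2)]
    by (cases "f = e") (auto simp: count_mset_set' Suc_le_eq)
  then have "add_mset e (mset_set E) \<subseteq># M" by (rule mset_subset_eqI)
  then show ?thesis using wf_pairs_double_con[OF assms(1,2), of x y] assms(4) e by simp
qed

lemma star_two:
  assumes "{u, x} \<in># M" "{u, y} \<in># M" "x \<noteq> y"
  obtains R where "star M u = R + {#{u, x}, {u, y}#}"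
proof -
  have "{u, x} \<in># star M u" "{u, y} \<in># star M u" "{u, x} \<noteq> {u, y}"
    using assms by (auto simp: star_def doubleton_eq_iff)
  then have "{#{u, x}, {u, y}#} \<subseteq># star M u"
    by (simp add: insert_subset_eq_iff in_diff_count)
  then have "star M u = (star M u - {#{u, x}, {u, y}#}) + {#{u, x}, {u, y}#}"
    by (simp only: subset_mset.diff_add)
  then show thesis using that by blast
qed

lemma star_neighbour:
  assumes "wf_pairs V M" "e \<in># star M u"
  shows "\<exists>p. e = {u, p} \<and> p \<in> V - {u}"
proof -
  have "e \<subseteq> V" "card e = 2" "u \<in> e" using assms by (auto simp: star_def wf_pairs_def)
  then show ?thesis by (auto simp: card_2_iff)
qed

text \<open>Two of the four edges are lifted to \<open>xy\<close>, and two remain to attach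
  \<open>u\<close> to the other vertices. It applies both to leaves and to the centre of a
  fan.\<close>

lemma star_size_four_con:
  assumes wf: "wf_pairs V M" and u: "u \<in> V" "size (star M u) \<ge> 4"
    and xy: "{u, x} \<in># M" "{u, y} \<in># M" "x \<noteq> y"
    and W: "\<And>p q. p \<in> V - {u} \<Longrightarrow> q \<in> V - {u} \<Longrightarrow> linked (add_mset {x, y} (del M {u})) p q"
  shows "Z3_con V M"
proof -
  obtain R where R: "star M u = R + {#{u, x}, {u, y}#}" using star_two[OF xy] .
  have R2: "size R \<ge> 2" using u(2) R by simp
  then obtain e R' where R': "R = add_mset e R'" by (cases R) auto
  then obtain f Q where "R' = add_mset f Q" using R2 by (cases R') auto
  then have Q: "R = add_mset e (add_mset f Q)" using R' by simp
  note nbr = star_neighbour[OF wf, of _ u]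
  obtain p q where pq: "e = {u, p}" "p \<in> V - {u}" "f = {u, q}" "q \<in> V - {u}"
    using nbr[of e] nbr[of f] R Q by auto
  have xyV: "x \<in> V - {u}" "y \<in> V - {u}"
    using nbr[of "{u, x}"] nbr[of "{u, y}"] R by (auto simp: doubleton_eq_iff)
  let ?N = "add_mset {x, y} (del M {u})"
  have M: "M = add_mset {u, x} (add_mset {u, y} (del M {u} + {#{u, p}, {u, q}#} + Q))"
    using del_star[of M u] R Q pq by (simp add: add_mset_commute)
  have V: "insert u (V - {u}) = V" using u(1) by auto
  have L0: "linked (?N + {#{u, p}, {u, q}#}) r s" if "r \<in> V" "s \<in> V" for r s
    using linked_new_vertex[of "V - {u}" ?N p q r u s, OF W pq(2,4)] that V by simp
  have "linked (?N + {#{u, p}, {u, q}#} + Q) r s" if "r \<in> V" "s \<in> V" for r s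
    by (rule linked_union[OF L0[OF that]])
  moreover have "?N + {#{u, p}, {u, q}#} + Q = add_mset {x, y} (del M {u} + {#{u, p}, {u, q}#} + Q)"
    by simp
  ultimately have L: "linked (add_mset {x, y} (del M {u} + {#{u, p}, {u, q}#} + Q)) r s" if "r \<in> V" "s \<in> V" for r s
    using that by (simp only:)
  have "wf_pairs V (add_mset {u, x} (add_mset {u, y} (del M {u} + {#{u, p}, {u, q}#} + Q)))"
    using wf M by (simp only:)
  then have "wf_pairs V (add_mset {x, y} (del M {u} + {#{u, p}, {u, q}#} + Q))"
    using xyV xy(3) by (simp add: wf_pairs_def)
  then have "Z3_con V (add_mset {x, y} (del M {u} + {#{u, p}, {u, q}#} + Q))"
    using L by (rule wf_pairs_linked_con)
  from Z3_con_lift[OF this, of u] show ?thesis using M by (simp only:)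
qed

lemma count_star: "x \<in> e \<Longrightarrow> count (star M x) e = count M e"
  by (simp add: star_def)

lemma not_Z3_con_cases:
  assumes wf: "wf_pairs V M" and T: "two_tree V E" "E \<subseteq> set_mset M" and card: "card V \<ge> 3"
    and nc: "\<not> Z3_con V M"
  shows "(card V = 3 \<or> card V = 4) \<and> (\<forall>x\<in>V. \<forall>y\<in>V. x \<noteq> y \<longrightarrow> count M {x, y} = 1) \<or>
    ear_reducible V M \<or> bull_reducible V M"
proof -
  have simple: "count M e = 1" if "e \<in> E" for e
  proof -
    have "count M e > 0" using that T(2) by auto
    moreover have "\<not> count M e \<ge> 2" using double_edge_con[OF wf T that] nc by blast
    ultimately show ?thesis by linarith
  qed
  show ?thesis
  proof (cases "card V = 3")
    case True
    obtain y z where "{y, z} \<in> E" using T(1) by cases auto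
    then obtain t where t: "t \<noteq> y" "t \<noteq> z" "y \<noteq> z" "V = {y, z, t}" "E = {{y, z}, {y, t}, {z, t}}"
      using two_tree_triangle[OF T(1) True] by metis
    have "{p, q} \<in> E" if "p \<in> V" "q \<in> V" "p \<noteq> q" for p q
      using that t by (auto simp: insert_commute)
    then show ?thesis using True simple by blast
  next
    case False
    then have "card V \<ge> 4" using card by simp
    from two_tree_fan[OF T(1) this] obtain V0 E0 v w b g L where F: "is_fan V0 E0 v w b g L"
      and Lne: "L \<noteq> {}" and V: "V = insert v V0 \<union> L" and E: "E = fan_edges E0 v w b g L"
      by metis
    note F' = F[unfolded is_fan_def]
    have T0: "two_tree V0 E0" "{w, b} \<in> E0" "v \<notin> V0" using F' by auto
    have wb: "w \<in> V0" "b \<in> V0" "w \<noteq> b" using two_tree_edgeD[OF T0(1,2)] by auto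
    have gu: "g u = w \<or> g u = b" if "u \<in> L" for u using F' that by auto
    have L: "u \<notin> V0" "u \<noteq> v" if "u \<in> L" for u using F' that by auto
    have e1: "{u, v} \<in> E" "{u, g u} \<in> E" if "u \<in> L" for u using that E by (auto simp: fan_edges_def)
    have e2: "{v, w} \<in> E" "{v, b} \<in> E" "E0 \<subseteq> E" using E by (auto simp: fan_edges_def)
    have vg: "v \<noteq> g u" "u \<noteq> v" "u \<noteq> g u" "g u \<in> V0" if "u \<in> L" for u
      using gu[OF that] L[OF that] wb T0 by auto
    have sub: "fan_edges E0 v w b g K \<subseteq> set_mset M" if "K \<subseteq> L" for K
      using that T(2) E by (auto simp: fan_edges_def)
    have tree: "two_tree (V - K) (fan_edges E0 v w b g (L - K))" if "K \<subseteq> L" for K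
    proof -
      have "insert v V0 \<union> (L - K) = V - K" using that F' V by auto
      then show ?thesis using is_fan_two_tree[OF is_fan_subset[OF F, of "L - K"]] by auto
    qed
    have vgT: "{v, g u} \<in> fan_edges E0 v w b g K" if "u \<in> L" for u K
      using gu[OF that] by (auto simp: fan_edges_def)
    show ?thesis
    proof (cases "ear_reducible V M")
      case True
      then show ?thesis by simp
    next
      case ne: False
      have "\<exists>c. star M u = {#{u, v}, {u, g u}, {u, c}#} \<and> c \<in> V - {u, v, g u}" if u: "u \<in> L" for u
      proof -
        have in_M: "{u, v} \<in># M" "{u, g u} \<in># M" using e1[OF u] T(2) by auto
        obtain R where R: "star M u = R + {#{u, v}, {u, g u}#}" using star_two[OF in_M vg(1)[OF u]] .
        have uV: "u \<in> V" using u V by auto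
        let ?T = "fan_edges E0 v w b g (L - {u})"
        have tr: "two_tree (V - {u}) ?T" "?T \<subseteq> set_mset M" using tree[of "{u}"] sub[of "L - {u}"] u by auto
        have "add_mset {v, g u} (mset_set ?T) \<subseteq># add_mset {v, g u} (del M {u})"
          using mset_set_subseteq_mset[OF two_tree_subset_del[OF tr]] by simp
        then have "size (star M u) < 4"
          using star_size_four_con[OF wf uV _ in_M vg(1)[OF u]]
            two_tree_double_linked[OF tr(1) vgT[OF u]] nc by (meson not_le)
        then have "size R \<le> 1" using R by simp
        moreover have "R \<noteq> {#}"
        proof
          assume "R = {#}"
          then have S: "star M u = {#{u, v}, {u, g u}#}" using R by simp
          have iV: "insert u (V - {u}) = V" using uV by auto
          have "v \<in> V - {u}" "g u \<in> V - {u}" using vg[OF u] V by auto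
          then have "Z3_con V M \<longleftrightarrow> Z3_con (V - {u}) (del M {u})"
            using Z3_con_ear[OF wf_pairs_del[OF wf, of "{u}"], of u v "g u"] del_star[of M u] S iV by auto
          then show False using ne nc S uV tr vgT[OF u] \<open>card V \<ge> 4\<close> unfolding ear_reducible_def by blast
        qed
        ultimately obtain e where e: "R = {#e#}"
          by (metis One_nat_def le_Suc_eq le_zero_eq size_1_singleton_mset size_eq_0_iff_empty)
        then obtain c where c: "e = {u, c}" "c \<in> V - {u}" using star_neighbour[OF wf, of e u] R by auto
        have cnt: "count (star M u) {u, v} = 1" "count (star M u) {u, g u} = 1"
          using simple e1[OF u] by (simp_all add: count_star)
        \<comment> \<open>Otherwise a tree edge would be doubled.\<close>
        then have "c \<noteq> v" "c \<noteq> g u" using R e c by (auto split: if_splits)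
        moreover have "star M u = {#{u, v}, {u, g u}, {u, c}#}" using R e c by (simp add: add_mset_commute)
        ultimately show ?thesis using c(2) by auto
      qed
      then obtain c where S: "\<And>u. u \<in> L \<Longrightarrow> star M u = {#{u, v}, {u, g u}, {u, c u}#}"
        and c: "\<And>u. u \<in> L \<Longrightarrow> c u \<in> V - {u, v, g u}" by metis
      have fin: "finite V" using wf by (simp add: wf_pairs_def)
      consider (adj) u where "u \<in> L" "c u \<in> L"
        | (deg) u where "u \<in> L" "\<And>u. u \<in> L \<Longrightarrow> c u \<in> V0" "size (star M v) < 4"
        | (con) "\<And>u. u \<in> L \<Longrightarrow> c u \<in> V0" "size (star M v) \<ge> 4"
        using c V Lne by fastforce
      then show ?thesis
      proof cases
        case adj
        \<comment> \<open>\<open>u\<close> and its third neighbour are both leaves: they form a bull with common neighbour \<open>v\<close>.\<close>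
        let ?u = "c u"
        note u = adj(1) and u' = adj(2)
        have ne': "?u \<noteq> u" using c[OF u] by auto
        have "{u, ?u} \<in># star M u" unfolding S[OF u] by simp
        then have "{u, ?u} \<in># star M ?u" by (simp add: star_def)
        \<comment> \<open>The tree neighbours of \<open>?u\<close> are \<open>v\<close> and a core
          vertex, so its edge to the leaf \<open>u\<close> is the third one.\<close>
        then have "{u, ?u} = {?u, c ?u}"
          using S[OF u'] L[OF u] vg[OF u'] vg[OF u] ne' by (auto simp: doubleton_eq_iff)
        then have S': "star M ?u = {#{?u, u}, {?u, v}, {?u, g ?u}#}"
          using S[OF u'] by (simp add: insert_commute add_mset_commute)
        have S'': "star M u = {#{?u, u}, {u, v}, {u, g u}#}"
          using S[OF u] by (simp add: insert_commute add_mset_commute)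
        have "card V \<ge> 5"
        proof -
          have "card (insert v V0) \<ge> 3" using two_tree_card[OF T0(1)] two_tree_finite[OF T0(1)] T0(3) by simp
          moreover have "card {u, ?u} = 2" using ne' by simp
          moreover have "insert v V0 \<union> {u, ?u} \<subseteq> V" using V u u' by auto
          moreover have "card (insert v V0 \<union> {u, ?u}) = card (insert v V0) + card {u, ?u}"
            using two_tree_finite[OF T0(1)] L u u' by (intro card_Un_disjoint) auto
          ultimately show ?thesis
            using card_mono[OF fin, of "insert v V0 \<union> {u, ?u}"] by linarith
        qed
        moreover have "two_tree (V - {?u, u}) (fan_edges E0 v w b g (L - {?u, u}))"
          using tree[of "{?u, u}"] u u' by simp
        ultimately have "bull_reducible V M"
          using S' S'' u u' ne' vg[OF u] vg[OF u'] V sub[of "L - {?u, u}"] vgT[OF u] L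
          by (intro bull_reducibleI[OF wf nc, of ?u u v "g ?u" "g u" "fan_edges E0 v w b g (L - {?u, u})"]) auto
        then show ?thesis by simp
      next
        case deg
        \<comment> \<open>\<open>u\<close> is the only leaf: \<open>u\<close> and \<open>v\<close> form a bull with common neighbour \<open>g u\<close>.\<close>
        note u = deg(1) and cu = deg(2)[OF deg(1)]
        \<comment> \<open>The end of the base edge other than \<open>g u\<close>, hence the third
          neighbour of \<open>v\<close> in the bull.\<close>
        define b' where "b' = (if g u = w then b else w)"
        have b': "{g u, b'} = {w, b}" "b' \<noteq> g u" "b' \<in> V0" using gu[OF u] wb by (auto simp: b'_def)
        have in_M: "{v, u'} \<in># M" if "u' \<in> L" for u'
          using e1(1)[OF that] T(2) by (auto simp: insert_commute)
        have "{v, w} \<in># M" "{v, b} \<in># M" using e2 T(2) by auto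
        then obtain R where R: "star M v = R + {#{v, w}, {v, b}#}" using star_two wb(3) by metis
        have R': "{v, u'} \<in># R" if "u' \<in> L" for u'
        proof -
          have "{v, u'} \<in># star M v" using in_M[OF that] by (simp add: star_def)
          then show ?thesis using R L[OF that] wb by (auto simp: doubleton_eq_iff)
        qed
        \<comment> \<open>Besides \<open>vw\<close> and \<open>vb\<close> there is room for one edge
          at \<open>v\<close>, but every leaf needs one.\<close>
        have "size R \<le> 1" using R deg(3) by simp
        then have Re: "R = {#{v, u}#}" using R'[OF u] by (cases R) auto
        have "u' = u" if "u' \<in> L" for u' using R'[OF that] Re by (auto simp: doubleton_eq_iff)
        then have "L = {u}" using u by blast
        have Sv: "star M v = {#{u, v}, {v, g u}, {v, b'}#}"
        proof -
          have "{#{v, w}, {v, b}#} = {#{v, g u}, {v, b'}#}"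
            using gu[OF u] wb(3) by (auto simp: b'_def add_mset_commute)
          then show ?thesis using R Re by (simp add: insert_commute)
        qed
        have Su: "star M u = {#{u, v}, {u, g u}, {u, c u}#}" using S[OF u] .
        have V': "V - {u, v} = V0" "V = insert u (insert v V0)" using V \<open>L = {u}\<close> L[OF u] T0(3) by auto
        show ?thesis
        proof (cases "card V \<ge> 5")
          case True
          have "bull_reducible V M"
            using Su Sv u cu vg[OF u] V b' T0 L[OF u] c[OF u] e2(3) T(2) True V'
            by (intro bull_reducibleI[OF wf nc, of u v "g u" "c u" b' E0]) auto
          then show ?thesis by simp
        next
          case False
          then have "card V = 4" using \<open>card V \<ge> 4\<close> by simp
          \<comment> \<open>The core is the bare base edge, so the third neighbour of
            \<open>u\<close> can only be \<open>b'\<close>, which completes K_4.\<close>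
          then have "card V0 = 2" using V'(2) L[OF u] T0(3) two_tree_finite[OF T0(1)] by simp
          moreover have "{w, b} \<subseteq> V0" "card {w, b} = 2" using wb by auto
          ultimately have V0: "V0 = {g u, b'}"
            using card_subset_eq[of V0 "{w, b}"] two_tree_finite[OF T0(1)] b'(1) by simp
          have cb: "c u = b'" using cu c[OF u] V0 by auto
          have "count M {u, v} = 1" "count M {u, g u} = 1" "count M {v, w} = 1" "count M {v, b} = 1"
            "count M {w, b} = 1"
            using simple e1[OF u] e2 T0(2) by auto
          moreover have "count (star M u) {u, c u} = 1"
            unfolding Su using c[OF u] vg[OF u] by (auto simp: doubleton_eq_iff)
          then have "count M {u, b'} = 1" using count_star[of u "{u, b'}" M] cb by simp
          moreover have "g u = w \<and> b' = b \<or> g u = b \<and> b' = w" using gu[OF u] by (auto simp: b'_def)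
          ultimately have "\<forall>x\<in>V. \<forall>y\<in>V. x \<noteq> y \<longrightarrow> count M {x, y} = 1"
            unfolding V'(2) V0 by (auto simp: insert_commute)
          then show ?thesis using \<open>card V = 4\<close> by simp
        qed
      next
        case con
        \<comment> \<open>Lifting \<open>vw\<close> and \<open>vb\<close> doubles \<open>wb\<close>, then all leaves and finally \<open>v\<close> are attached by two edges.\<close>
        have vV: "v \<in> V" using V by auto
        let ?N = "add_mset {w, b} (del M {v})"
        \<comment> \<open>Only the edges inside the core, with \<open>wb\<close> doubled. Each leaf
          is linked to it separately, through its own two edges.\<close>
        let ?M0 = "add_mset {w, b} (del (del M {v}) L)"
        have "E0 \<subseteq> set_mset (del (del M {v}) L)"
          using two_tree_edge[OF T0(1)] e2(3) T(2) T0(3) L by (fastforce simp: del_def)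
        then have "add_mset {w, b} (mset_set E0) \<subseteq># ?M0" using mset_set_subseteq_mset by simp
        note L0 = two_tree_double_linked[OF T0(1,2) this]
        have "?M0 \<subseteq># ?N" by (simp add: del_def)
        have base: "linked ?N p q" if "p \<in> V0" "q \<in> V0" for p q
          using linked_mono[OF L0[OF that] \<open>?M0 \<subseteq># ?N\<close>] .
        have leaf: "linked ?N u (g u)" if u: "u \<in> L" for u
        proof -
          have "linked (?M0 + {#{u, g u}, {u, c u}#}) u (g u)"
            using linked_attach[OF L0[of "g u" "c u"]] vg[OF u] con(1)[OF u] by simp
          moreover have "?M0 + {#{u, g u}, {u, c u}#} \<subseteq># ?N"
          proof -
            have "{#e \<in># star (del M {v}) u. True#} = filter_mset (\<lambda>e. v \<notin> e) (star M u)"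
              by (auto simp: star_def del_def filter_filter_mset intro!: filter_mset_cong)
            then have "star (del M {v}) u = {#{u, g u}, {u, c u}#}"
              unfolding S[OF u] using vg[OF u] con(1)[OF u] T0(3) by auto
            moreover have "del (del M {v}) L + star (del M {v}) u \<subseteq># del M {v}"
            proof -
              have "del (del M {v}) L \<subseteq># del (del M {v}) {u}"
                using u by (intro mset_subset_eqI) (auto simp: del_def)
              then have "del (del M {v}) L + star (del M {v}) u \<subseteq># del (del M {v}) {u} + star (del M {v}) u"
                by simp
              then show ?thesis using del_star[of "del M {v}" u] by simp
            qed
            ultimately show ?thesis by (simp add: add_mset_commute)
          qed
          ultimately show ?thesis by (rule linked_mono)
        qed
        have all: "linked ?N p w" if "p \<in> V - {v}" for p
        proof (cases "p \<in> L")
          case True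
          show ?thesis using linked_trans[OF leaf[OF True] base] vg[OF True] wb by simp
        next
          case False
          then show ?thesis using base wb that V by simp
        qed
        have "Z3_con V M"
        proof (rule star_size_four_con[OF wf vV con(2) _ _ wb(3)])
          fix p q assume pq: "p \<in> V - {v}" "q \<in> V - {v}"
          show "linked ?N p q" using linked_trans[OF all[OF pq(1)] linked_sym[OF all[OF pq(2)]]] .
        qed (use e2 T(2) in auto)
        then show ?thesis using nc by simp
      qed
    qed
  qed
qed

section \<open>Multigraphs as multisets of pairs\<close>

definition pairs :: "('v, 'e) mgraph \<Rightarrow> 'v set multiset" where
  "pairs G = image_mset (ends G) (mset_set (edges G))"

lemma multigraphD:
  assumes "multigraph G"
  shows "finite (vertices G)" "finite (edges G)" "\<And>e. e \<in> edges G \<Longrightarrow> ends G e \<subseteq> vertices G"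
    "\<And>e. e \<in> edges G \<Longrightarrow> card (ends G e) = 2"
  using assms by (auto simp: multigraph_def)

lemma set_pairs: "multigraph G \<Longrightarrow> set_mset (pairs G) = ends G ` edges G"
  by (simp add: pairs_def multigraphD(2))

lemma wf_pairs_pairs: "multigraph G \<Longrightarrow> wf_pairs (vertices G) (pairs G)"
  unfolding wf_pairs_def using set_pairs[of G] multigraphD[of G] by auto

text \<open>The multiset in \<open>realizes\<close> does not tell parallel edges apart; the
  induction hands out its ordered pairs to individual edges.\<close>

lemma realizes_image_mset_iff:
  assumes "finite S" "\<And>e. e \<in> S \<Longrightarrow> \<exists>x y. en e = {x, y}"
  shows "realizes (image_mset en (mset_set S)) f \<longleftrightarrow>
    (\<exists>t h. (\<forall>e\<in>S. {t e, h e} = en e) \<and> f = (\<Sum>e\<in>S. arc (t e) (h e)))"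
proof
  assume "realizes (image_mset en (mset_set S)) f"
  with assms show "\<exists>t h. (\<forall>e\<in>S. {t e, h e} = en e) \<and> f = (\<Sum>e\<in>S. arc (t e) (h e))"
  proof (induction S arbitrary: f rule: finite_induct)
    case (insert e S)
    obtain x y where xy: "en e = {x, y}" using insert.prems(1) by blast
    have "realizes (add_mset {x, y} (image_mset en (mset_set S))) f"
      using insert.prems(2) insert.hyps xy by simp
    then obtain a b where ab: "{a, b} = en e" and R: "realizes (image_mset en (mset_set S)) (f - arc a b)"
      unfolding realizes_add_iff using xy arc_flip[of y x]
      by (metis diff_minus_eq_add insert_commute)
    have "\<And>e. e \<in> S \<Longrightarrow> \<exists>x y. en e = {x, y}" using insert.prems(1) by simp
    from insert.IH[OF this R] obtain t h where th: "\<forall>e\<in>S. {t e, h e} = en e"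
      "f - arc a b = (\<Sum>e\<in>S. arc (t e) (h e))" by blast
    have "(\<Sum>e'\<in>S. arc ((t(e := a)) e') ((h(e := b)) e')) = (\<Sum>e\<in>S. arc (t e) (h e))"
      by (rule sum.cong) (use insert.hyps in auto)
    then have "(\<Sum>e'\<in>insert e S. arc ((t(e := a)) e') ((h(e := b)) e')) = arc a b + (f - arc a b)"
      using insert.hyps th(2) by simp
    also have "\<dots> = f" by simp
    finally have "f = (\<Sum>e'\<in>insert e S. arc ((t(e := a)) e') ((h(e := b)) e'))" ..
    moreover have "\<forall>e'\<in>insert e S. {(t(e := a)) e', (h(e := b)) e'} = en e'" using th(1) ab by simp
    ultimately show ?case by blast
  qed auto
next
  assume "\<exists>t h. (\<forall>e\<in>S. {t e, h e} = en e) \<and> f = (\<Sum>e\<in>S. arc (t e) (h e))"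
  then obtain t h where th: "\<forall>e\<in>S. {t e, h e} = en e" "f = (\<Sum>e\<in>S. arc (t e) (h e))" by blast
  have "image_mset (\<lambda>e. {t e, h e}) (mset_set S) = image_mset en (mset_set S)"
    by (rule image_mset_cong) (use th(1) \<open>finite S\<close> in auto)
  then have "image_mset (\<lambda>(x, y). {x, y}) (image_mset (\<lambda>e. (t e, h e)) (mset_set S)) = image_mset en (mset_set S)"
    by (simp add: multiset.map_comp comp_def)
  moreover have "f = (\<Sum>(x, y)\<in>#image_mset (\<lambda>e. (t e, h e)) (mset_set S). arc x y)"
    using th(2) by (simp add: sum_unfold_sum_mset multiset.map_comp comp_def)
  ultimately show "realizes (image_mset en (mset_set S)) f" unfolding realizes_def by blast
qed

lemma of_int_three_eq_iff: "(of_int x :: 3) = of_int y \<longleftrightarrow> [x = y] (mod 3)"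
  by (simp add: of_int_eq_iff_cong_CHAR)

lemma sum_arc_degree:
  assumes "finite (arcs D)"
  shows "(\<Sum>e\<in>arcs D. arc (tail D e) (head D e)) p = of_int (int (out_degree D p) - int (in_degree D p))"
proof -
  have "(\<Sum>e\<in>S. arc (tail D e) (head D e)) p = (\<Sum>e\<in>S. arc (tail D e) (head D e) p)" if "finite S" for S
    using that by (induction S rule: finite_induct) auto
  then have "(\<Sum>e\<in>arcs D. arc (tail D e) (head D e)) p =
      (\<Sum>e\<in>arcs D. of_bool (p = tail D e)) - (\<Sum>e\<in>arcs D. of_bool (p = head D e))"
    using assms by (simp add: arc_def sum_subtractf)
  moreover have "{e \<in> arcs D. p = tail D e} = out_arcs D p" "{e \<in> arcs D. p = head D e} = in_arcs D p"
    by (auto simp: out_arcs_def in_arcs_def)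
  ultimately show ?thesis
    using assms by (simp add: sum.inter_filter[symmetric] of_bool_def out_degree_def in_degree_def)
qed

lemma realizes_orientation_iff:
  assumes G: "multigraph G" and f: "\<forall>p. p \<notin> vertices G \<longrightarrow> f p = 0"
  shows "realizes (pairs G) f \<longleftrightarrow> (\<exists>D. orientation G D \<and>
    (\<forall>v\<in>vertices G. of_int (int (out_degree D v) - int (in_degree D v)) = f v))"
proof -
  have en: "\<exists>x y. ends G e = {x, y}" if "e \<in> edges G" for e
    using multigraphD(4)[OF G that] by (auto simp: card_2_iff)
  have R: "realizes (pairs G) g \<longleftrightarrow>
      (\<exists>t h. (\<forall>e\<in>edges G. {t e, h e} = ends G e) \<and> g = (\<Sum>e\<in>edges G. arc (t e) (h e)))" for g
    unfolding pairs_def using multigraphD(2)[OF G] en by (rule realizes_image_mset_iff)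
  show ?thesis
  proof
    assume "realizes (pairs G) f"
    then obtain t h where th: "\<forall>e\<in>edges G. {t e, h e} = ends G e"
      "f = (\<Sum>e\<in>edges G. arc (t e) (h e))" unfolding R by blast
    define D where "D = \<lparr>verts = vertices G, arcs = edges G, tail = t, head = h\<rparr>"
    have "orientation G D" using th(1) by (simp add: orientation_def D_def)
    moreover have "f = (\<Sum>e\<in>arcs D. arc (tail D e) (head D e))" using th(2) by (simp add: D_def)
    then have "of_int (int (out_degree D v) - int (in_degree D v)) = f v" for v
      using sum_arc_degree[of D v] multigraphD(2)[OF G] by (simp add: D_def)
    ultimately show "\<exists>D. orientation G D \<and>
      (\<forall>v\<in>vertices G. of_int (int (out_degree D v) - int (in_degree D v)) = f v)" by blast
  next
    assume "\<exists>D. orientation G D \<and>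
      (\<forall>v\<in>vertices G. of_int (int (out_degree D v) - int (in_degree D v)) = f v)"
    then obtain D where D: "orientation G D"
      "\<forall>v\<in>vertices G. of_int (int (out_degree D v) - int (in_degree D v)) = f v" by blast
    have arcs: "arcs D = edges G" and th: "\<forall>e\<in>edges G. {tail D e, head D e} = ends G e"
      using D(1) by (auto simp: orientation_def)
    let ?g = "\<Sum>e\<in>edges G. arc (tail D e) (head D e)"
    have g: "realizes (pairs G) ?g" unfolding R using th by blast
    have "?g v = f v" for v
    proof (cases "v \<in> vertices G")
      case True
      then show ?thesis using sum_arc_degree[of D v] D(2) arcs multigraphD(2)[OF G] by simp
    next
      case False
      have "?g v = 0" using realizes_support[OF g, of v] False set_pairs[OF G] multigraphD(3)[OF G] by auto
      then show ?thesis using f False by simp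
    qed
    then have "?g = f" by (rule ext)
    then show "realizes (pairs G) f" using g by simp
  qed
qed

lemma Z3_connected_iff:
  assumes G: "multigraph G"
  shows "Z3_connected G \<longleftrightarrow> Z3_con (vertices G) (pairs G)"
proof
  assume con: "Z3_connected G"
  show "Z3_con (vertices G) (pairs G)" unfolding Z3_con_def
  proof (intro allI impI)
    fix f :: "'a \<Rightarrow> 3"
    assume f: "\<forall>p. p \<notin> vertices G \<longrightarrow> f p = 0" "sum f (vertices G) = 0"
    have "\<exists>z. of_int z = s" for s :: 3
      by (cases s rule: three_cases) (metis of_int_0, metis of_int_1, metis of_int_1 of_int_minus)
    then obtain r :: "3 \<Rightarrow> int" where r: "\<And>s. of_int (r s) = s" by metis
    have "(of_int (\<Sum>v\<in>vertices G. r (f v)) :: 3) = of_int 0" using f(2) r by simp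
    then have "Z3_boundary G (\<lambda>v. r (f v))" unfolding Z3_boundary_def of_int_three_eq_iff .
    then obtain D where "orientation G D"
      "\<forall>v\<in>vertices G. [int (out_degree D v) - int (in_degree D v) = r (f v)] (mod 3)"
      using con unfolding Z3_connected_def by blast
    then show "realizes (pairs G) f"
      unfolding realizes_orientation_iff[OF G f(1)] of_int_three_eq_iff[symmetric] r by blast
  qed
next
  assume con: "Z3_con (vertices G) (pairs G)"
  show "Z3_connected G" unfolding Z3_connected_def
  proof (intro allI impI)
    fix \<beta> assume \<beta>: "Z3_boundary G \<beta>"
    \<comment> \<open>\<open>\<beta>\<close> is unrestricted outside the graph and is cut off to 0
      there.\<close>
    define f :: "'a \<Rightarrow> 3" where "f = (\<lambda>p. if p \<in> vertices G then of_int (\<beta> p) else 0)"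
    have "sum f (vertices G) = of_int (\<Sum>v\<in>vertices G. \<beta> v)" by (simp add: f_def)
    also have "\<dots> = of_int 0" using \<beta> unfolding Z3_boundary_def of_int_three_eq_iff .
    finally have s: "sum f (vertices G) = 0" by simp
    have f: "\<forall>p. p \<notin> vertices G \<longrightarrow> f p = 0" by (simp add: f_def)
    have "realizes (pairs G) f" using con f s unfolding Z3_con_def by simp
    then obtain D where "orientation G D"
      and D: "\<And>v. v \<in> vertices G \<Longrightarrow> of_int (int (out_degree D v) - int (in_degree D v)) = f v"
      unfolding realizes_orientation_iff[OF G f] by blast
    moreover have "[int (out_degree D v) - int (in_degree D v) = \<beta> v] (mod 3)" if "v \<in> vertices G" for v
      unfolding of_int_three_eq_iff[symmetric] using D[OF that] that by (simp add: f_def)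
    ultimately show "\<exists>D. orientation G D \<and>
        (\<forall>v\<in>vertices G. [int (out_degree D v) - int (in_degree D v) = \<beta> v] (mod 3))" by blast
  qed
qed

section \<open>Spanning triangle-trees in terms of pairs\<close>

lemma triangle_tree_two_tree:
  "triangle_tree T \<Longrightarrow> finite (edges T) \<and> two_tree (vertices T) (ends T ` edges T) \<and> card (vertices T) \<ge> 3"
proof (induction rule: triangle_tree.induct)
  case (triangle T)
  then have T: "multigraph T" "card (vertices T) = 3" and
    ex: "\<And>u v. u \<in> vertices T \<Longrightarrow> v \<in> vertices T \<Longrightarrow> u \<noteq> v \<Longrightarrow> {u, v} \<in> ends T ` edges T"
    unfolding complete_graph_def by (auto, metis imageI)
  then obtain x y z where V: "vertices T = {x, y, z}" "x \<noteq> y" "x \<noteq> z" "y \<noteq> z"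
    by (auto simp: card_3_iff)
  have "ends T ` edges T = {{x, y}, {x, z}, {y, z}}"
  proof
    show "ends T ` edges T \<subseteq> {{x, y}, {x, z}, {y, z}}"
    proof
      fix d assume "d \<in> ends T ` edges T"
      then have "d \<subseteq> {x, y, z}" "card d = 2" using multigraphD[OF T(1)] V(1) by auto
      then obtain p q where "d = {p, q}" "p \<noteq> q" "p \<in> {x, y, z}" "q \<in> {x, y, z}"
        by (auto simp: card_2_iff)
      then show "d \<in> {{x, y}, {x, z}, {y, z}}" by (auto simp: insert_commute)
    qed
    show "{{x, y}, {x, z}, {y, z}} \<subseteq> ends T ` edges T" using ex V by simp
  qed
  moreover have "two_tree {x, y, z} {{x, y}, {x, z}, {y, z}}"
    using two_tree.extend[OF two_tree.edge[OF V(4)], of x y z] V by simp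
  ultimately show ?case using V(1) T multigraphD(2) by simp
next
  case (extend T x y z e f)
  then have yz: "{y, z} \<in> ends T ` edges T" by (auto simp: adjacent_def image_iff)
  let ?T = "add_edge (add_edge (add_vertex T x) e x y) f x z"
  have "ends ?T ` edges ?T = insert {x, y} (insert {x, z} (ends T ` edges T))"
  proof -
    have "ends ?T ` edges T = ends T ` edges T"
      by (rule image_cong) (use extend.hyps in \<open>auto simp: add_edge_def add_vertex_def\<close>)
    then show ?thesis using extend.hyps by (simp add: add_edge_def add_vertex_def insert_commute)
  qed
  moreover have "vertices ?T = insert x (vertices T)" by (simp add: add_edge_def add_vertex_def)
  moreover have "finite (edges ?T)" using extend.IH by (simp add: add_edge_def add_vertex_def)
  moreover have "finite (vertices T)" using extend.IH two_tree_finite by blast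
  ultimately show ?case
    using extend.IH two_tree.extend[of "vertices T" "ends T ` edges T" x y z] yz extend.hyps by simp
qed

text \<open>\<open>h\<close> selects an edge for each pair, and \<open>en\<close> is kept as the
  ends of the surrounding graph, so the result is a subgraph of it. As \<open>two_tree\<close>
  starts from an edge, the initial triangle arises in the extension of a two-vertex tree.\<close>

lemma two_tree_triangle_tree:
  assumes "two_tree V E" "card V \<ge> 3" "\<And>d. d \<in> E \<Longrightarrow> en (h d) = d"
  shows "triangle_tree \<lparr>vertices = V, edges = h ` E, ends = en\<rparr>"
  using assms
proof (induction rule: two_tree.induct)
  case (edge x y)
  then show ?case by simp
next
  case (extend V E x y z)
  note yz = two_tree_edgeD[OF extend.hyps(1,3)]
  note fin = two_tree_finite[OF extend.hyps(1)]
  have en: "\<And>d. d \<in> E \<Longrightarrow> en (h d) = d" "en (h {x, y}) = {x, y}" "en (h {x, z}) = {x, z}"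
    using extend.prems(2) by auto
  show ?case
  proof (cases "card V \<ge> 3")
    case True
    let ?T = "\<lparr>vertices = V, edges = h ` E, ends = en\<rparr>"
    have new: "h {x, c} \<notin> h ` E" if c: "en (h {x, c}) = {x, c}" for c
    proof
      assume "h {x, c} \<in> h ` E"
      then obtain d where "d \<in> E" "h {x, c} = h d" by blast
      then have "{x, c} \<in> E" using en(1)[of d] c by simp
      then show False using two_tree_edgeD[OF extend.hyps(1)] extend.hyps(2) by blast
    qed
    have ne: "h {x, y} \<noteq> h {x, z}"
    proof
      assume "h {x, y} = h {x, z}"
      then have "{x, y} = {x, z}" using en(2,3) by metis
      then show False using yz by (auto simp: doubleton_eq_iff)
    qed
    have "adjacent ?T y z" using extend.hyps(3) en(1) by (auto simp: adjacent_def)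
    then have "triangle_tree (add_edge (add_edge (add_vertex ?T x) (h {x, y}) x y) (h {x, z}) x z)"
      using extend.IH[OF True en(1)] extend.hyps(2) new[OF en(2)] new[OF en(3)] ne
      by (intro triangle_tree.extend) auto
    \<comment> \<open>\<open>add_edge\<close> overwrites \<open>en\<close> only with values that it
      already has.\<close>
    moreover have "(en(h {x, y} := {x, y}))(h {x, z} := {x, z}) = en"
      using en by (auto simp: fun_eq_iff)
    ultimately show ?thesis by (simp add: add_edge_def add_vertex_def insert_commute)
  next
    case False
    then have "card V = 2" using two_tree_card[OF extend.hyps(1)] by simp
    moreover have "{y, z} \<subseteq> V" "card {y, z} = 2" using yz by auto
    ultimately have V: "V = {y, z}" using card_subset_eq[of V "{y, z}"] fin by simp
    have E: "E = {{y, z}}"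
    proof -
      have "d = {y, z}" if "d \<in> E" for d
        using two_tree_edge[OF extend.hyps(1) that] card_subset_eq[of V d] V \<open>card V = 2\<close> fin by auto
      then show ?thesis using extend.hyps(3) by blast
    qed
    have en': "en (h {y, z}) = {y, z}" using en(1) E by simp
    have x: "x \<noteq> y" "x \<noteq> z" using extend.hyps(2) V by auto
    let ?T = "\<lparr>vertices = insert x V, edges = h ` insert {x, y} (insert {x, z} E), ends = en\<rparr>"
    have "card (insert x V) = 3" using \<open>card V = 2\<close> extend.hyps(2) fin by simp
    moreover have "multigraph ?T" using en(2,3) en' x yz unfolding multigraph_def V E by auto
    moreover have "\<exists>!e. e \<in> edges ?T \<and> ends ?T e = {p, q}"
      if "p \<in> vertices ?T" "q \<in> vertices ?T" "p \<noteq> q" for p q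
    proof -
      have "{p, q} = {x, y} \<or> {p, q} = {x, z} \<or> {p, q} = {y, z}" using that V by (auto simp: doubleton_eq_iff)
      then have 1: "{p, q} \<in> insert {x, y} (insert {x, z} E)" unfolding E by simp
      show ?thesis
      proof (rule ex1I[of _ "h {p, q}"])
        show "h {p, q} \<in> edges ?T \<and> ends ?T (h {p, q}) = {p, q}"
          using imageI[OF 1, of h] extend.prems(2)[OF 1] by (simp only: mgraph.simps simp_thms)
        fix e assume "e \<in> edges ?T \<and> ends ?T e = {p, q}"
        then obtain d where "d \<in> insert {x, y} (insert {x, z} E)" "e = h d" "en e = {p, q}" by auto
        then show "e = h {p, q}" using extend.prems(2)[of d] by simp
      qed
    qed
    ultimately have "complete_graph 3 ?T" unfolding complete_graph_def by simp
    then show ?thesis by (rule triangle_tree.triangle)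
  qed
qed

lemma has_spanning_triangle_tree_iff:
  assumes G: "multigraph G"
  shows "has_spanning_triangle_tree G \<longleftrightarrow>
    card (vertices G) \<ge> 3 \<and> (\<exists>E. two_tree (vertices G) E \<and> E \<subseteq> set_mset (pairs G))"
proof
  assume "has_spanning_triangle_tree G"
  then obtain T where T: "triangle_tree T" "subgraph_of T G" "vertices T = vertices G"
    unfolding has_spanning_triangle_tree_def by blast
  have "ends T ` edges T \<subseteq> ends G ` edges G" using T(2) by (auto simp: subgraph_of_def)
  then show "card (vertices G) \<ge> 3 \<and> (\<exists>E. two_tree (vertices G) E \<and> E \<subseteq> set_mset (pairs G))"
    using triangle_tree_two_tree[OF T(1)] T(3) set_pairs[OF G] by auto
next
  assume "card (vertices G) \<ge> 3 \<and> (\<exists>E. two_tree (vertices G) E \<and> E \<subseteq> set_mset (pairs G))"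
  then obtain E where E: "card (vertices G) \<ge> 3" "two_tree (vertices G) E" "E \<subseteq> ends G ` edges G"
    using set_pairs[OF G] by auto
  then have "\<forall>d\<in>E. \<exists>e. e \<in> edges G \<and> ends G e = d" by auto
  then obtain h where h: "\<And>d. d \<in> E \<Longrightarrow> h d \<in> edges G \<and> ends G (h d) = d" by metis
  let ?T = "\<lparr>vertices = vertices G, edges = h ` E, ends = ends G\<rparr>"
  have "triangle_tree ?T" using two_tree_triangle_tree[OF E(2,1), of "ends G" h] h by simp
  moreover have "h ` E \<subseteq> edges G" using h by auto
  then have "subgraph_of ?T G"
    using G two_tree_finite[OF E(2)] by (auto simp: subgraph_of_def multigraph_def subset_iff)
  ultimately show "has_spanning_triangle_tree G"
    unfolding has_spanning_triangle_tree_def by (intro exI[of _ ?T]) simp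
qed

lemma adjacent_iff: "multigraph G \<Longrightarrow> adjacent G u v \<longleftrightarrow> {u, v} \<in># pairs G"
  by (auto simp: adjacent_def set_pairs image_iff)

lemma star_pairs:
  "multigraph G \<Longrightarrow> star (pairs G) x = image_mset (ends G) (mset_set {e \<in> edges G. x \<in> ends G e})"
  by (simp add: star_def pairs_def filter_mset_image_mset multigraphD(2))

lemma size_star_pairs: "multigraph G \<Longrightarrow> size (star (pairs G) x) = degree G x"
  by (simp add: star_pairs degree_def)

lemma multigraph_delete_vertices: "multigraph G \<Longrightarrow> multigraph (delete_vertices G S)"
  by (auto simp: multigraph_def delete_vertices_def)

lemma pairs_delete_vertices: "multigraph G \<Longrightarrow> pairs (delete_vertices G S) = del (pairs G) S"
  by (simp add: del_def pairs_def filter_mset_image_mset multigraphD(2) delete_vertices_def)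

lemma pairs_add_edge:
  assumes "multigraph G" "e \<notin> edges G"
  shows "pairs (add_edge G e a b) = add_mset {a, b} (pairs G)"
proof -
  have "image_mset ((ends G)(e := {a, b})) (mset_set (edges G)) = pairs G"
    unfolding pairs_def by (rule image_mset_cong) (use assms multigraphD(2)[OF assms(1)] in auto)
  then show ?thesis using assms multigraphD(2)[OF assms(1)] by (simp add: pairs_def add_edge_def)
qed

lemma multigraph_add_edge:
  "multigraph G \<Longrightarrow> e \<notin> edges G \<Longrightarrow> a \<in> vertices G \<Longrightarrow> b \<in> vertices G \<Longrightarrow> a \<noteq> b \<Longrightarrow>
    multigraph (add_edge G e a b)"
  by (auto simp: multigraph_def add_edge_def)

lemma count_pairs: "multigraph G \<Longrightarrow> count (pairs G) d = card {e \<in> edges G. ends G e = d}"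
  by (simp add: pairs_def count_image_mset' multigraphD(2) eq_commute)

lemma complete_graph_iff:
  assumes "multigraph G"
  shows "complete_graph n G \<longleftrightarrow> card (vertices G) = n \<and>
    (\<forall>x\<in>vertices G. \<forall>y\<in>vertices G. x \<noteq> y \<longrightarrow> count (pairs G) {x, y} = 1)"
proof -
  have "count (pairs G) d = 1 \<longleftrightarrow> (\<exists>!e. e \<in> edges G \<and> ends G e = d)" for d
    unfolding count_pairs[OF assms] One_nat_def card_1_singleton_iff
    by (auto simp: set_eq_iff Ex1_def)
  then show ?thesis using assms unfolding complete_graph_def by simp
qed

section \<open>Complete graphs that are not Z3-connected\<close>

lemma Z3_con_loop: "Z3_con V (add_mset {a} M) \<longleftrightarrow> Z3_con V M"
  using realizes_add_iff[of a a M] by (simp add: Z3_con_def)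

text \<open>The zero boundary fails: the only edge contributes 1 or -1 at \<open>x\<close>.\<close>

lemma single_edge_not_Z3_con:
  assumes "x \<noteq> y"
  shows "\<not> Z3_con {x, y} {#{x, y}#}"
proof
  assume "Z3_con {x, y} {#{x, y}#}"
  then have "realizes (add_mset {x, y} {#}) 0" unfolding Z3_con_def by simp
  then have "arc x y = 0" unfolding realizes_add_iff by simp
  then have "arc x y x = 0" by (metis zero_fun_apply)
  then show False using assms by (simp add: arc_def)
qed

lemma wf_pairs_eqI:
  assumes "wf_pairs V M" "wf_pairs V N" "\<And>x y. x \<in> V \<Longrightarrow> y \<in> V \<Longrightarrow> x \<noteq> y \<Longrightarrow> count M {x, y} = count N {x, y}"
  shows "M = N"
proof (rule multiset_eqI)
  fix e
  show "count M e = count N e"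
  proof (cases "e \<subseteq> V \<and> card e = 2")
    case True
    then obtain x y where "e = {x, y}" "x \<noteq> y" by (auto simp: card_2_iff)
    then show ?thesis using assms(3) True by auto
  next
    case False
    then show ?thesis using assms(1,2) unfolding wf_pairs_def by (metis not_in_iff)
  qed
qed

lemma complete_graph_3_not_con:
  assumes "wf_pairs V M" "card V = 3" "\<And>x y. x \<in> V \<Longrightarrow> y \<in> V \<Longrightarrow> x \<noteq> y \<Longrightarrow> count M {x, y} = 1"
  shows "\<not> Z3_con V M"
proof -
  obtain x y z where V: "V = {x, y, z}" "x \<noteq> y" "x \<noteq> z" "y \<noteq> z"
    using assms(2) by (auto simp: card_3_iff)
  have "M = {#{y, z}#} + {#{x, y}, {x, z}#}"
    by (rule wf_pairs_eqI[OF assms(1)]) (use V assms(3) in \<open>auto simp: wf_pairs_def doubleton_eq_iff\<close>)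
  moreover have "\<not> Z3_con (insert x {y, z}) ({#{y, z}#} + {#{x, y}, {x, z}#})"
    using V single_edge_not_Z3_con[OF V(4)] by (subst Z3_con_ear) (auto simp: wf_pairs_def)
  ultimately show ?thesis using V(1) by simp
qed

lemma complete_graph_4_not_con:
  assumes "wf_pairs V M" "card V = 4" "\<And>x y. x \<in> V \<Longrightarrow> y \<in> V \<Longrightarrow> x \<noteq> y \<Longrightarrow> count M {x, y} = 1"
  shows "\<not> Z3_con V M"
proof
  obtain u W where W: "V = insert u W" "u \<notin> W" "card W = 3"
    using card_eq_SucD[of V 3] assms(2) by auto
  then obtain v w b where W': "W = {v, w, b}" "v \<noteq> w" "v \<noteq> b" "w \<noteq> b"
    by (auto simp: card_3_iff)
  have u: "u \<noteq> v" "u \<noteq> w" "u \<noteq> b" using W W' by auto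
  have M: "M = {#{w, b}#} + {#{u, v}, {u, w}, {u, b}, {v, w}, {v, b}#}"
    by (rule wf_pairs_eqI[OF assms(1)])
      (use W(1) W' u assms(3) in \<open>auto simp: wf_pairs_def doubleton_eq_iff\<close>)
  assume "Z3_con V M"
  then have "Z3_con (insert u (insert v {w, b})) ({#{w, b}#} + {#{u, v}, {u, w}, {u, b}, {v, w}, {v, b}#})"
    using M W(1) W'(1) by simp
  \<comment> \<open>Both \<open>u\<close> and \<open>v\<close> have \<open>b\<close> as third
    neighbour, so the added pair is a loop and drops out.\<close>
  then have "Z3_con {w, b} (add_mset {b, b} {#{w, b}#})"
    using W' u by (intro Z3_con_bullD[of "{w, b}" "{#{w, b}#}" u v w b b]) (auto simp: wf_pairs_def)
  then show False using single_edge_not_Z3_con[OF W'(4)] by (simp add: Z3_con_loop)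
qed

lemma star_three:
  assumes "{u, x} \<in># M" "{u, y} \<in># M" "{u, z} \<in># M" "x \<noteq> y" "x \<noteq> z" "y \<noteq> z" "size (star M u) = 3"
  shows "star M u = {#{u, x}, {u, y}, {u, z}#}"
proof -
  obtain R where R: "star M u = R + {#{u, x}, {u, y}#}" using star_two[OF assms(1,2,4)] .
  have "{u, z} \<in># star M u" using assms(3) by (simp add: star_def)
  then have "{u, z} \<in># R" using R assms(4-6) by (auto simp: doubleton_eq_iff)
  moreover have "size R = 1" using R assms(7) by simp
  ultimately have "R = {#{u, z}#}" by (cases R) auto
  then show ?thesis using R by (simp add: add_mset_commute)
qed

text \<open>As loops have no effect, \<open>add_mset {a, b}\<close> describes both branches of
  \<open>H\<close> at once.\<close>

lemma bull_reduction_pairs: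
  assumes G: "multigraph G" and ab: "a \<in> vertices G - S" "b \<in> vertices G - S"
    and e: "e \<notin> edges (delete_vertices G S)"
    and H: "H = (if a = b then delete_vertices G S else add_edge (delete_vertices G S) e a b)"
  shows "multigraph H" "vertices H = vertices G - S" "set_mset (del (pairs G) S) \<subseteq> set_mset (pairs H)"
    "Z3_connected H \<longleftrightarrow> Z3_con (vertices G - S) (add_mset {a, b} (del (pairs G) S))"
proof -
  note D = multigraph_delete_vertices[OF G, of S]
  have V: "vertices (delete_vertices G S) = vertices G - S" by (simp add: delete_vertices_def)
  show mH: "multigraph H" using H D multigraph_add_edge[OF D e] V ab by simp
  show VH: "vertices H = vertices G - S" using H V by (simp add: add_edge_def)
  have P: "pairs H = (if a = b then del (pairs G) S else add_mset {a, b} (del (pairs G) S))"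
    using H pairs_add_edge[OF D e] pairs_delete_vertices[OF G] by simp
  show "set_mset (del (pairs G) S) \<subseteq> set_mset (pairs H)" unfolding P by auto
  show "Z3_connected H \<longleftrightarrow> Z3_con (vertices G - S) (add_mset {a, b} (del (pairs G) S))"
    unfolding Z3_connected_iff[OF mH] VH P by (auto simp: Z3_con_loop)
qed

section \<open>Reductions of pairs and of multigraphs\<close>

lemma ear_reducible_two_sum:
  assumes G: "multigraph G" and ear: "ear_reducible (vertices G) (pairs G)"
  obtains A G1 where "complete_graph 3 A" "two_sum G A G1" "\<not> Z3_connected G1" "has_spanning_triangle_tree G1"
proof -
  obtain x y z E where x: "x \<in> vertices G" and S: "star (pairs G) x = {#{x, y}, {x, z}#}"
    and yz: "{y, z} \<in> E" and T: "two_tree (vertices G - {x}) E" "E \<subseteq> set_mset (pairs G)"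
    and card: "card (vertices G) \<ge> 4" and nc: "\<not> Z3_con (vertices G - {x}) (del (pairs G) {x})"
    using ear unfolding ear_reducible_def by blast
  note fin = multigraphD[OF G]
  have yz': "y \<in> vertices G" "z \<in> vertices G" "y \<noteq> x" "z \<noteq> x" "y \<noteq> z"
    using two_tree_edgeD[OF T(1) yz] by auto
  let ?X = "{e \<in> edges G. x \<in> ends G e}"
  have X: "image_mset (ends G) (mset_set ?X) = {#{x, y}, {x, z}#}" using S star_pairs[OF G] by simp
  have "ends G ` ?X = {{x, y}, {x, z}}"
    using arg_cong[OF X, of set_mset] fin(2) by simp
  then have "{x, y} \<in> ends G ` ?X" "{x, z} \<in> ends G ` ?X" by auto
  then obtain e1 e2 where e: "e1 \<in> ?X" "ends G e1 = {x, y}" "e2 \<in> ?X" "ends G e2 = {x, z}" by auto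
  have e12: "e1 \<noteq> e2" using e yz' by (auto simp: doubleton_eq_iff)
  have "card ?X = 2" using arg_cong[OF X, of size] by simp
  then have X': "?X = {e1, e2}"
    using card_subset_eq[of ?X "{e1, e2}"] e e12 fin(2) by simp
  \<comment> \<open>If \<open>yz\<close> has parallel edges, any one of them serves as the common
    edge; all of them stay in the second summand.\<close>
  obtain e3 where e3: "e3 \<in> edges G" "ends G e3 = {y, z}"
    using yz T(2) set_pairs[OF G] by force
  have e3': "e3 \<noteq> e1" "e3 \<noteq> e2" using e e3 yz' by (auto simp: doubleton_eq_iff)
  define A where "A = \<lparr>vertices = {x, y, z}, edges = {e1, e2, e3}, ends = ends G\<rparr>"
  define G1 where "G1 = delete_vertices G {x}"
  have G1: "multigraph G1" unfolding G1_def by (rule multigraph_delete_vertices[OF G])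
  have VG1: "vertices G1 = vertices G - {x}" by (simp add: G1_def delete_vertices_def)
  have EG1: "edges G1 = edges G - {e1, e2}" using X' by (auto simp: G1_def delete_vertices_def)
  have enG1: "ends G1 = ends G" by (simp add: G1_def delete_vertices_def)
  have A: "multigraph A" using e e3 yz' by (auto simp: multigraph_def A_def)
  have "pairs A = {#{x, y}, {x, z}, {y, z}#}"
    using e e3 e12 e3' by (simp add: pairs_def A_def add_mset_commute)
  then have "complete_graph 3 A"
    unfolding complete_graph_iff[OF A] using yz' by (auto simp: A_def doubleton_eq_iff)
  moreover have "two_sum G A G1"
  proof -
    have "edges A \<inter> edges G1 = {e3}" using EG1 e3 e3' by (auto simp: A_def)
    moreover have "vertices A \<inter> vertices G1 = {y, z}" using VG1 yz' by (auto simp: A_def)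
    moreover have "edges G = edges A \<union> edges G1" using EG1 e e3 by (auto simp: A_def)
    moreover have "vertices G = vertices A \<union> vertices G1" using VG1 x yz' by (auto simp: A_def)
    ultimately show ?thesis
      using G A G1 yz' enG1 unfolding two_sum_def subgraph_of_def by (auto simp: A_def)
  qed
  moreover have P: "pairs G1 = del (pairs G) {x}" unfolding G1_def by (rule pairs_delete_vertices[OF G])
  then have "\<not> Z3_connected G1" unfolding Z3_connected_iff[OF G1] VG1 using nc by simp
  moreover have "has_spanning_triangle_tree G1"
    unfolding has_spanning_triangle_tree_iff[OF G1] VG1 P
    using two_tree_subset_del[OF T] T(1) card x fin(1) by auto
  ultimately show thesis using that by blast
qed

lemma bull_reducible_bull_growing:
  assumes G: "multigraph G" and bull: "bull_reducible (vertices G) (pairs G)"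
  obtains H where "bull_growing H G" "\<not> Z3_connected H" "has_spanning_triangle_tree H"
proof -
  obtain u v w a b E where V: "u \<in> vertices G" "v \<in> vertices G" "w \<in> vertices G - {u, v}"
      "a \<in> vertices G - {u, v, w}" "b \<in> vertices G - {u, v, w}"
    and S: "star (pairs G) u = {#{u, v}, {u, w}, {u, a}#}" "star (pairs G) v = {#{u, v}, {v, w}, {v, b}#}"
    and T: "two_tree (vertices G - {u, v}) E" "E \<subseteq> set_mset (pairs G)"
    and card: "card (vertices G) \<ge> 5"
    and nc: "\<not> Z3_con (vertices G - {u, v}) (add_mset {a, b} (del (pairs G) {u, v}))"
    using bull unfolding bull_reducible_def by blast
  have "e \<in># pairs G" if "e \<in># star (pairs G) u \<or> e \<in># star (pairs G) v" for e
    using that by (auto simp: star_def)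
  then have adj: "adjacent G u v" "adjacent G u w" "adjacent G v w" "adjacent G u a" "adjacent G v b"
    unfolding adjacent_iff[OF G] S by auto
  have deg: "degree G u = 3" "degree G v = 3"
    using size_star_pairs[OF G, of u] size_star_pairs[OF G, of v] unfolding S by auto
  \<comment> \<open>The deleted edge \<open>uv\<close> is reused as the new edge between
    \<open>a\<close> and \<open>b\<close>.\<close>
  obtain e where "e \<in> edges G" "ends G e = {u, v}" using adj(1) by (auto simp: adjacent_def)
  then have e: "e \<notin> edges (delete_vertices G {u, v})" by (simp add: delete_vertices_def)
  define H where "H = (if a = b then delete_vertices G {u, v} else add_edge (delete_vertices G {u, v}) e a b)"
  have ab: "a \<in> vertices G - {u, v}" "b \<in> vertices G - {u, v}" using V by auto
  note H = bull_reduction_pairs[OF G ab e H_def]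
  have "adjacent G u v \<and> degree G u = 3 \<and> degree G v = 3 \<and> adjacent G u w \<and> adjacent G v w \<and>
      adjacent G u a \<and> a \<noteq> v \<and> a \<noteq> w \<and> adjacent G v b \<and> b \<noteq> u \<and> b \<noteq> w \<and>
      e \<notin> edges (delete_vertices G {u, v}) \<and>
      H = (if a = b then delete_vertices G {u, v} else add_edge (delete_vertices G {u, v}) e a b)"
    using V by (intro conjI adj deg e H_def) auto
  then have "bull_growing H G"
    unfolding bull_growing_def bull_reduction_def by (intro conjI[OF G] exI)
  moreover have "\<not> Z3_connected H" using H(4) nc by simp
  moreover have "has_spanning_triangle_tree H"
  proof -
    have "card {u, v} \<le> 2" by (simp add: card_insert_if)
    then have "card (vertices G - {u, v}) \<ge> 3"
      using card diff_card_le_card_Diff[of "{u, v}" "vertices G"] by simp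
    then show ?thesis unfolding has_spanning_triangle_tree_iff[OF H(1)] H(2)
      using T(1) two_tree_subset_del[OF T] H(3) by blast
  qed
  ultimately show thesis using that by blast
qed

text \<open>The common edge lies in \<open>G1\<close>, hence avoids the vertex \<open>x\<close> of
  \<open>A\<close> outside \<open>G1\<close> and is the edge \<open>yz\<close> of \<open>A\<close>.
  So \<open>G\<close> is \<open>G1\<close> with an ear at \<open>x\<close>.\<close>

lemma two_sum_not_con:
  assumes "complete_graph 3 A" "two_sum G A G1" "\<not> Z3_connected G1"
  shows "\<not> Z3_connected G"
proof -
  have G: "multigraph G" "multigraph A" "multigraph G1" and
    V: "vertices G = vertices A \<union> vertices G1" "card (vertices A \<inter> vertices G1) = 2" and
    E: "edges G = edges A \<union> edges G1" "card (edges A \<inter> edges G1) = 1" and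
    en: "\<And>e. e \<in> edges A \<Longrightarrow> ends A e = ends G e" "\<And>e. e \<in> edges G1 \<Longrightarrow> ends G1 e = ends G e"
    using assms(2) unfolding two_sum_def subgraph_of_def by auto
  obtain y z where yz: "vertices A \<inter> vertices G1 = {y, z}" "y \<noteq> z" using V(2) by (auto simp: card_2_iff)
  have cA: "card (vertices A) = 3" using assms(1) by (simp add: complete_graph_def)
  have "{y, z} \<subseteq> vertices A" using yz(1) by blast
  then have "card (vertices A - {y, z}) = 1"
    using cA yz(2) card_Diff_subset[of "{y, z}" "vertices A"] by simp
  then obtain x where "vertices A - {y, z} = {x}" by (auto simp: card_1_singleton_iff)
  then have VA: "vertices A = {x, y, z}" and x: "x \<notin> vertices G1" "x \<noteq> y" "x \<noteq> z" and
    yzG1: "y \<in> vertices G1" "z \<in> vertices G1"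
    using yz by auto
  have ex1: "\<exists>!e. e \<in> edges A \<and> ends A e = {p, q}" if "p \<in> {x, y, z}" "q \<in> {x, y, z}" "p \<noteq> q" for p q
    using assms(1) that VA unfolding complete_graph_def by blast
  obtain e1 where e1: "e1 \<in> edges A" "ends A e1 = {x, y}" using ex1[of x y] x yz(2) by auto
  obtain e2 where e2: "e2 \<in> edges A" "ends A e2 = {x, z}" using ex1[of x z] x yz(2) by auto
  have no_x: "x \<notin> ends G e" if "e \<in> edges G1" for e
    using multigraphD(3)[OF G(3) that] en(2)[OF that] x(1) by auto
  have yz_only: "ends A e = {y, z}" if "e \<in> edges A" "x \<notin> ends A e" for e
  proof -
    have "ends A e \<subseteq> {y, z}" using multigraphD(3)[OF G(2) that(1)] that(2) VA by auto
    then show ?thesis using card_subset_eq[of "{y, z}" "ends A e"] multigraphD(4)[OF G(2) that(1)] yz(2) by simp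
  qed
  have edges: "edges G = insert e1 (insert e2 (edges G1))"
  proof -
    obtain e3 where "edges A \<inter> edges G1 = {e3}" using E(2) by (auto simp: card_1_singleton_iff)
    then have e3: "e3 \<in> edges A" "e3 \<in> edges G1" by auto
    then have e3': "ends A e3 = {y, z}" using yz_only no_x en(1) by simp
    have "e \<in> insert e1 (insert e2 (edges G1))" if e: "e \<in> edges A" for e
    proof (cases "x \<in> ends A e")
      case True
      have "\<exists>p. ends A e = {x, p} \<and> p \<noteq> x"
        using True multigraphD(4)[OF G(2) e] by (auto simp: card_2_iff)
      then obtain p where "ends A e = {x, p}" "p \<noteq> x" by blast
      moreover have "p \<in> {x, y, z}" using calculation multigraphD(3)[OF G(2) e] VA by auto
      ultimately consider "ends A e = {x, y}" | "ends A e = {x, z}" by auto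
      then show ?thesis
      proof cases
        case 1
        then have "e = e1" using ex1[of x y] e1 e x by blast
        then show ?thesis by simp
      next
        case 2
        then have "e = e2" using ex1[of x z] e2 e x by blast
        then show ?thesis by simp
      qed
    next
      case False
      then have "e = e3" using ex1[of y z] yz_only[OF e] e3(1) e3' e yz(2) by blast
      then show ?thesis using e3(2) by simp
    qed
    then show ?thesis using E(1) e1(1) e2(1) by auto
  qed
  have "{x, y} \<noteq> {x, z}" using yz(2) by (auto simp: doubleton_eq_iff)
  then have "e1 \<noteq> e2" using e1(2) e2(2) by metis
  moreover have "e1 \<notin> edges G1" using no_x[of e1] en(1)[of e1] e1 by auto
  moreover have "e2 \<notin> edges G1" using no_x[of e2] en(1)[of e2] e2 by auto
  ultimately have new: "e1 \<notin> edges G1" "e2 \<notin> edges G1" "e1 \<noteq> e2" by auto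
  have "image_mset (ends G) (mset_set (edges G1)) = pairs G1"
    unfolding pairs_def by (rule image_mset_cong) (use en(2) multigraphD(2)[OF G(3)] in auto)
  then have P: "pairs G = pairs G1 + {#{x, y}, {x, z}#}"
    using new e1 e2 en(1) multigraphD(2)[OF G(3)] unfolding pairs_def[of G] edges
    by (simp add: add_mset_commute)
  have VG: "vertices G = insert x (vertices G1)" using V(1) VA yzG1 by auto
  show ?thesis
    using assms(3) Z3_con_ear[OF wf_pairs_pairs[OF G(3)] x(1) yzG1]
    unfolding Z3_connected_iff[OF G(1)] Z3_connected_iff[OF G(3)] P VG by simp
qed

text \<open>Degree 3 and three distinct neighbours determine the edges at \<open>u\<close> and at
  \<open>v\<close> completely, so that \<open>Z3_con_bullD\<close> applies.\<close>

lemma bull_growing_not_con: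
  assumes "bull_growing H G" "\<not> Z3_connected H"
  shows "\<not> Z3_connected G"
proof
  assume con: "Z3_connected G"
  obtain u v w a b e where G: "multigraph G" and
    adj: "adjacent G u v" "adjacent G u w" "adjacent G v w" "adjacent G u a" "adjacent G v b" and
    deg: "degree G u = 3" "degree G v = 3" and
    ne: "a \<noteq> v" "a \<noteq> w" "b \<noteq> u" "b \<noteq> w" and
    e: "e \<notin> edges (delete_vertices G {u, v})" and
    H: "H = (if a = b then delete_vertices G {u, v} else add_edge (delete_vertices G {u, v}) e a b)"
    using assms(1) unfolding bull_growing_def bull_reduction_def by blast
  have edge: "p \<in> vertices G" "q \<in> vertices G" "p \<noteq> q" if "adjacent G p q" for p q
    using that multigraphD(3,4)[OF G] unfolding adjacent_def by (auto split: if_splits)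
      (metis card_2_iff doubleton_eq_iff insert_absorb2)
  note uv = edge[OF adj(1)] and uw = edge[OF adj(2)] and vw = edge[OF adj(3)]
    and ua = edge[OF adj(4)] and vb = edge[OF adj(5)]
  note adj' = adj[unfolded adjacent_iff[OF G]]
  have Su: "star (pairs G) u = {#{u, v}, {u, w}, {u, a}#}"
    using adj' ne vw deg size_star_pairs[OF G] by (intro star_three) auto
  have "star (pairs G) v = {#{v, u}, {v, w}, {v, b}#}"
    using adj' ne uw deg size_star_pairs[OF G] by (intro star_three) (auto simp: insert_commute)
  then have Sv: "star (pairs G) v = {#{u, v}, {v, w}, {v, b}#}" by (simp add: insert_commute)
  have M: "pairs G = del (pairs G) {u, v} + {#{u, v}, {u, w}, {u, a}, {v, w}, {v, b}#}"
    using uv uw vw ua vb ne by (intro bull_stars[OF _ _ _ _ Su Sv]) auto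
  have V: "insert u (insert v (vertices G - {u, v})) = vertices G" using uv by auto
  have ab: "a \<in> vertices G - {u, v}" "b \<in> vertices G - {u, v}" using ua vb ne by auto
  have "Z3_con (insert u (insert v (vertices G - {u, v})))
      (del (pairs G) {u, v} + {#{u, v}, {u, w}, {u, a}, {v, w}, {v, b}#})"
    using con M V unfolding Z3_connected_iff[OF G] by simp
  then have "Z3_con (vertices G - {u, v}) (add_mset {a, b} (del (pairs G) {u, v}))"
    using uv uw vw ab by (intro Z3_con_bullD[OF wf_pairs_del[OF wf_pairs_pairs[OF G]], of u "{u, v}" v w]) auto
  then show False using assms(2) bull_reduction_pairs(4)[OF G ab e H] by simp
qed

theorem theorem1p9:
  fixes G :: "('v, 'e) mgraph"
  assumes "multigraph G"
    and "has_spanning_triangle_tree G"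
  shows "\<not> Z3_connected G \<longleftrightarrow>
    (complete_graph 3 G \<or> complete_graph 4 G) \<or>
    (\<exists>A G1 :: ('v, 'e) mgraph. complete_graph 3 A \<and> two_sum G A G1 \<and>
       \<not> Z3_connected G1 \<and> has_spanning_triangle_tree G1) \<or>
    (\<exists>H :: ('v, 'e) mgraph. bull_growing H G \<and>
       \<not> Z3_connected H \<and> has_spanning_triangle_tree H)"
  (is "_ \<longleftrightarrow> ?complete \<or> ?two_sum \<or> ?bull")
proof
  assume nc: "\<not> Z3_connected G"
  obtain E where E: "card (vertices G) \<ge> 3" "two_tree (vertices G) E" "E \<subseteq> set_mset (pairs G)"
    using assms(2) unfolding has_spanning_triangle_tree_iff[OF assms(1)] by blast
  from not_Z3_con_cases[OF wf_pairs_pairs[OF assms(1)] E(2,3,1)] nc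
  consider "?complete" | "ear_reducible (vertices G) (pairs G)" | "bull_reducible (vertices G) (pairs G)"
    unfolding Z3_connected_iff[OF assms(1)] complete_graph_iff[OF assms(1)] by blast
  then show "?complete \<or> ?two_sum \<or> ?bull"
  proof cases
    case 1
    then show ?thesis by blast
  next
    case 2
    then show ?thesis using ear_reducible_two_sum[OF assms(1)] by metis
  next
    case 3
    then show ?thesis using bull_reducible_bull_growing[OF assms(1)] by metis
  qed
next
  assume "?complete \<or> ?two_sum \<or> ?bull"
  then consider "?complete" | "?two_sum" | "?bull" by blast
  then show "\<not> Z3_connected G"
  proof cases
    case 1
    then show ?thesis
      unfolding Z3_connected_iff[OF assms(1)] complete_graph_iff[OF assms(1)]
      using complete_graph_3_not_con complete_graph_4_not_con wf_pairs_pairs[OF assms(1)] by blast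
  next
    case 2
    then show ?thesis using two_sum_not_con by blast
  next
    case 3
    then show ?thesis using bull_growing_not_con by blast
  qed
qed

end
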